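(* Let $\lambda>-1/2$, $\lambda\neq 0$, and $\rho>1$. There is a sequence of positive numbers $c=c_n$ with $c_n\to1$ as $n\to\infty$ such that the following holds for all $n\ge 1$. Let $u$ be analytic on and within the Bernstein ellipse $\mathcal E_\rho$, let $M_\rho=\max_{z\in\mathcal E_\rho}|u(z)|$, and let $I_nu$ be the polynomial of degree at most $n$ interpolating $u$ at the $n+1$ Gegenbauer-Gauss points $\{x_j\}_{j=0}^n$ (the zeros of $C_{n+1}^\lambda$). Then $$\max_{0\le j\le n}|(u-I_nu)'(x_j)|\le \Lambda(\rho,\lambda)\,\frac{n^{\lambda+2}}{\rho^n},$$ where $$\Lambda(\rho,\lambda)=\frac{2c\,\Gamma(\lambda+1)M_\rho\sqrt{\rho^2+\rho^{-2}}}{\Gamma(2\lambda+2)(\rho-1)^2}\cdot\begin{cases}(1+\rho^{-2})^{\lambda},& \lambda>0,\\ (1-\rho^{-2})^{\lambda},&\lambda<0.\end{cases}$$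
   Context: For $\lambda>-1/2$, $\lambda\ne0$, the Gegenbauer polynomials are defined by $C_0^\lambda(x)=1$, $C_1^\lambda(x)=2\lambda x$, and $nC_n^\lambda(x)=2(n+\lambda-1)xC_{n-1}^\lambda(x)-(n+2\lambda-2)C_{n-2}^\lambda(x)$ for $n\ge2$. They are orthogonal on $[-1,1]$ with respect to the weight $(1-x^2)^{\lambda-1/2}$, so $C_{n+1}^\lambda$ has $n+1$ distinct zeros in $(-1,1)$. For $\rho>1$ the Bernstein ellipse is $\mathcal E_\rho=\{z\in\mathbb C: z=\tfrac12(w+w^{-1}),\ w=\rho e^{\mathrm i\theta},\ \theta\in[0,2\pi]\}$; it has foci $\pm1$. *)

theory Defs
  imports
    "HOL-Complex_Analysis.Complex_Analysis"
    "HOL-Computational_Algebra.Polynomial"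
begin

fun gegenbauer :: "real \<Rightarrow> nat \<Rightarrow> real poly" where
  "gegenbauer l 0 = 1"
| "gegenbauer l (Suc 0) = [:0, 2 * l:]"
| "gegenbauer l (Suc (Suc m)) =
     (let n = real (m + 2) in
      smult (1 / n)
        (smult (2 * (n + l - 1)) ([:0, 1:] * gegenbauer l (Suc m))
         - smult (n + 2 * l - 2) (gegenbauer l m)))"

text \<open>For \<open>l > -1/2\<close>, \<open>l \<noteq> 0\<close>, all \<open>n + 1\<close> zeros of the polynomial of index \<open>n + 1\<close>
  are real and simple and lie in \<open>(-1, 1)\<close>, so the set of its real zeros is exactly
  the set of nodes.\<close>

definition gegenbauer_gauss_points :: "real \<Rightarrow> nat \<Rightarrow> real set" where
  "gegenbauer_gauss_points l n = {x. poly (gegenbauer l (n + 1)) x = 0}"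

definition bernstein_ellipse :: "real \<Rightarrow> complex set" where
  "bernstein_ellipse \<rho> =
     {z. \<exists>w \<theta>. \<theta> \<in> {0..2 * pi} \<and> w = complex_of_real \<rho> * exp (\<i> * complex_of_real \<theta>)
              \<and> z = (w + inverse w) / 2}"

definition is_gauss_interpolant ::
  "real \<Rightarrow> nat \<Rightarrow> (complex \<Rightarrow> complex) \<Rightarrow> complex poly \<Rightarrow> bool" where
  "is_gauss_interpolant l n u p \<longleftrightarrow>
     degree p \<le> n \<and>
     (\<forall>x \<in> gegenbauer_gauss_points l n. poly p (complex_of_real x) = u (complex_of_real x))"

text \<open>For \<open>u\<close> continuous on the (compact) ellipse the supremum is a maximum.\<close>

definition ellipse_max :: "real \<Rightarrow> (complex \<Rightarrow> complex) \<Rightarrow> real" where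
  "ellipse_max \<rho> u = (SUP z \<in> bernstein_ellipse \<rho>. cmod (u z))"

definition Lambda_bound :: "real \<Rightarrow> real \<Rightarrow> real \<Rightarrow> real \<Rightarrow> real" where
  "Lambda_bound c M \<rho> l =
     2 * c * Gamma (l + 1) * M * sqrt (\<rho> powi 2 + \<rho> powi (-2))
       / (Gamma (2 * l + 2) * (\<rho> - 1)^2)
     * (if l > 0 then (1 + \<rho> powi (-2)) powr l else (1 - \<rho> powi (-2)) powr l)"

end

theory Submission
  imports Defs "HOL-Computational_Algebra.Fundamental_Theorem_Algebra"
begin

text \<open>
  Write \<open>P\<close> for the Gegenbauer polynomial of index \<open>n + 1\<close> and \<open>g k = (l)\<^sub>k / k!\<close>.
  Hermite's remainder formula represents \<open>u - I\<^sub>n u\<close> as \<open>P\<close> times a Cauchy integral of \<open>u /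
  P\<close> over the ellipse, so that \<open>(u - I\<^sub>n u)'(x\<^sub>j) = P'(x\<^sub>j) / (2 \<pi> i) \<cdot> \<integral> u(z) /
  (P(z) (z - x\<^sub>j)) dz\<close>. Here \<open>P'\<close> is \<open>2 l\<close> times the polynomial of parameter \<open>l + 1 >
  0\<close>, whose maximum on \<open>[-1, 1]\<close> is attained at \<open>1\<close>; the ellipse has length at most \<open>\<pi>
  \<surd>(\<rho>\<^sup>2 + \<rho>\<^sup>-\<^sup>2)\<close> and distance \<open>(\<rho> - 1)\<^sup>2 / (2 \<rho>)\<close> from
  \<open>[-1, 1]\<close>. On the ellipse \<open>z = (w + w\<^sup>-\<^sup>1) / 2\<close> the generating function gives
  \<open>C\<^sub>m(z) = w\<^sup>m \<Sum>\<^sub>k g k g (m - k) w\<^sup>-\<^sup>2\<^sup>k\<close>, and by dominated convergence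
  \<open>C\<^sub>m(z) / (g m w\<^sup>m)\<close> tends to \<open>(1 - w\<^sup>-\<^sup>2)\<^sup>-\<^sup>l\<close> uniformly in
  \<open>w\<close>. The growth \<open>n\<^sup>l\<^sup>+\<^sup>2\<close> comes from Gauss' product formula for the Gamma function.
\<close>

subsection \<open>Gegenbauer polynomials\<close>

definition joukowski :: "complex \<Rightarrow> complex" where
  "joukowski w = (w + inverse w) / 2"

definition cgegenbauer :: "real \<Rightarrow> nat \<Rightarrow> complex poly" where
  "cgegenbauer l n = map_poly complex_of_real (gegenbauer l n)"

text \<open>These are the Taylor coefficients of \<open>(1 - v) powr (- l)\<close>, see
  \<open>gcoeff_sums\<close>. For \<open>-1/2 < l < 0\<close> all of them except the first are
  negative, hence the absolute values further on.\<close>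

definition gcoeff :: "real \<Rightarrow> nat \<Rightarrow> real" where
  "gcoeff l k = pochhammer l k / fact k"

lemma poly_map_poly_of_real:
  "poly (map_poly complex_of_real p) (complex_of_real x) = complex_of_real (poly p x)"
  by (induction p) (auto simp: map_poly_pCons)

lemma pderiv_map_poly_of_real:
  "pderiv (map_poly complex_of_real p) = map_poly complex_of_real (pderiv p)"
  by (intro poly_eqI) (simp add: coeff_pderiv coeff_map_poly)

lemma poly_cgegenbauer_of_real:
  "poly (cgegenbauer l n) (complex_of_real x) = complex_of_real (poly (gegenbauer l n) x)"
  by (simp add: cgegenbauer_def poly_map_poly_of_real)

lemma poly_pderiv_cgegenbauer_of_real:
  "poly (pderiv (cgegenbauer l n)) (complex_of_real x) =
     complex_of_real (poly (pderiv (gegenbauer l n)) x)"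
  by (simp add: cgegenbauer_def pderiv_map_poly_of_real poly_map_poly_of_real)

text \<open>Clearing the denominator avoids divisions in the inductions below, which derive an
  identity multiplied by the index and then cancel that factor.\<close>

lemma gegenbauer_rec:
  "smult (real (Suc (Suc m))) (gegenbauer l (Suc (Suc m))) =
     smult (2 * (real m + 1 + l)) (pCons 0 (gegenbauer l (Suc m)))
     - smult (real m + 2 * l) (gegenbauer l m)"
  by (simp add: Let_def algebra_simps)

declare gegenbauer.simps(3) [simp del]

lemma poly_gegenbauer_rec:
  "(real m + 2) * poly (gegenbauer l (Suc (Suc m))) x =
     2 * (real m + 1 + l) * x * poly (gegenbauer l (Suc m)) x
     - (real m + 2 * l) * poly (gegenbauer l m) x"
  using arg_cong[OF gegenbauer_rec[of m l], of "\<lambda>p. poly p x"] by (simp add: algebra_simps)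

lemma poly_pderiv_gegenbauer_rec:
  "(real m + 2) * poly (pderiv (gegenbauer l (Suc (Suc m)))) x =
     2 * (real m + 1 + l) *
       (poly (gegenbauer l (Suc m)) x + x * poly (pderiv (gegenbauer l (Suc m))) x)
     - (real m + 2 * l) * poly (pderiv (gegenbauer l m)) x"
  using arg_cong[OF gegenbauer_rec[of m l], of "\<lambda>p. poly (pderiv p) x"]
  by (simp add: pderiv_smult pderiv_diff pderiv_pCons algebra_simps)

lemma coeff_gegenbauer_rec:
  "(real m + 2) * coeff (gegenbauer l (Suc (Suc m))) i =
     2 * (real m + 1 + l) * coeff (pCons 0 (gegenbauer l (Suc m))) i
     - (real m + 2 * l) * coeff (gegenbauer l m) i"
  using arg_cong[OF gegenbauer_rec[of m l], of "\<lambda>p. coeff p i"]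
  by (cases i) (simp_all add: algebra_simps)

lemma cgegenbauer_0 [simp]: "cgegenbauer l 0 = 1"
  by (simp add: cgegenbauer_def)

lemma cgegenbauer_1 [simp]: "cgegenbauer l (Suc 0) = [:0, complex_of_real (2 * l):]"
  by (simp add: cgegenbauer_def map_poly_pCons)

lemma poly_cgegenbauer_rec:
  "(of_nat m + 2) * poly (cgegenbauer l (Suc (Suc m))) z =
     2 * (of_nat m + 1 + of_real l) * z * poly (cgegenbauer l (Suc m)) z
     - (of_nat m + 2 * of_real l) * poly (cgegenbauer l m) z"
proof -
  have "smult (of_nat m + 2) (cgegenbauer l (Suc (Suc m))) =
     smult (2 * (of_nat m + 1 + of_real l)) (pCons 0 (cgegenbauer l (Suc m)))
     - smult (of_nat m + 2 * of_real l) (cgegenbauer l m)"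
  proof (rule poly_eqI)
    fix i
    have "coeff (pCons 0 (cgegenbauer l (Suc m))) i =
        complex_of_real (coeff (pCons 0 (gegenbauer l (Suc m))) i)"
      by (cases i) (simp_all add: cgegenbauer_def coeff_map_poly)
    then show "coeff (smult (of_nat m + 2) (cgegenbauer l (Suc (Suc m)))) i =
        coeff (smult (2 * (of_nat m + 1 + of_real l)) (pCons 0 (cgegenbauer l (Suc m)))
          - smult (of_nat m + 2 * of_real l) (cgegenbauer l m)) i"
      using arg_cong[OF coeff_gegenbauer_rec[of m l i], of complex_of_real]
      by (cases i) (simp_all add: cgegenbauer_def coeff_map_poly)
  qed
  from arg_cong[OF this, of "\<lambda>p. poly p z"] show ?thesis
    by (simp add: algebra_simps)
qed

section \<open>Differentiation raises the parameter\<close>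

text \<open>Induction with the recurrences of both parameters. Starting at index
  \<open>m + 2\<close> avoids subtraction of naturals, and \<open>l > -1/2\<close> keeps the
  cancelled factor \<open>m + 2 + l\<close> nonzero. It is the link that
  \<open>pderiv_gegenbauer\<close> needs between the two parameters.\<close>

lemma gegenbauer_lift_param:
  "(real m + 2 + l) * poly (gegenbauer l (m + 2)) x =
     l * (poly (gegenbauer (l + 1) (m + 2)) x - poly (gegenbauer (l + 1) m) x)"
  if "l > -1/2"
proof (induction m rule: induct_nat_012)
  case 0
  have "2 * poly (gegenbauer l 2) x = 2 * (1 + l) * x * (2 * l * x) - 2 * l"
    "2 * poly (gegenbauer (l + 1) 2) x = 2 * (2 + l) * x * (2 * (l + 1) * x) - 2 * (l + 1)"
    using poly_gegenbauer_rec[of 0 l x] poly_gegenbauer_rec[of 0 "l+1" x]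
    by (simp_all add: numeral_2_eq_2 algebra_simps)
  then have "2 * ((2 + l) * poly (gegenbauer l 2) x - l * (poly (gegenbauer (l + 1) 2) x - 1)) = 0"
    by algebra
  then show ?case by (simp add: numeral_2_eq_2)
next
  case 1
  have 2: "poly (gegenbauer l 2) x = 2 * l * (1 + l) * x\<^sup>2 - l"
    "poly (gegenbauer (l + 1) 2) x = 2 * (l + 1) * (l + 2) * x\<^sup>2 - (l + 1)"
    using poly_gegenbauer_rec[of 0 l x] poly_gegenbauer_rec[of 0 "l+1" x]
    by (simp_all add: numeral_2_eq_2 algebra_simps)
  have 3: "3 * poly (gegenbauer l 3) x = 2 * (2 + l) * x * poly (gegenbauer l 2) x - (1 + 2 * l) * (2 * l * x)"
    "3 * poly (gegenbauer (l + 1) 3) x =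
       2 * (3 + l) * x * poly (gegenbauer (l + 1) 2) x - (3 + 2 * l) * (2 * (l + 1) * x)"
    using poly_gegenbauer_rec[of 1 l x] poly_gegenbauer_rec[of 1 "l+1" x]
    by (simp_all add: eval_nat_numeral algebra_simps)
  have "3 * ((3 + l) * poly (gegenbauer l 3) x) =
      (3 + l) * (2 * (2 + l) * x * poly (gegenbauer l 2) x - (1 + 2 * l) * (2 * l * x))"
    unfolding 3(1)[symmetric] by (simp only: ac_simps)
  also have "\<dots> = l * (2 * (3 + l) * x * poly (gegenbauer (l + 1) 2) x - (3 + 2 * l) * (2 * (l + 1) * x)
      - 3 * (2 * (l + 1) * x))"
    unfolding 2 by (simp add: algebra_simps power2_eq_square)
  also have "\<dots> = 3 * (l * (poly (gegenbauer (l + 1) 3) x - 2 * (l + 1) * x))"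
    unfolding 3(2)[symmetric] by (simp add: algebra_simps)
  finally show ?case by (simp add: eval_nat_numeral)
next
  case (ge2 m)
  define C where "C j = poly (gegenbauer l (m + j)) x" for j
  define E where "E j = poly (gegenbauer (l + 1) (m + j)) x" for j
  define r where "r = real m"
  have c: "(r + 4) * C 4 = 2 * (r + 3 + l) * x * C 3 - (r + 2 + 2 * l) * C 2"
    using poly_gegenbauer_rec[of "m + 2" l x]
    by (simp add: C_def r_def eval_nat_numeral algebra_simps)
  have e4: "(r + 4) * E 4 = 2 * (r + 4 + l) * x * E 3 - (r + 4 + 2 * l) * E 2"
    using poly_gegenbauer_rec[of "m + 2" "l + 1" x]
    by (simp add: E_def r_def eval_nat_numeral algebra_simps)
  have e2: "(r + 2) * E 2 = 2 * (r + 2 + l) * x * E 1 - (r + 2 + 2 * l) * E 0"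
    using poly_gegenbauer_rec[of m "l + 1" x]
    by (simp add: E_def r_def eval_nat_numeral algebra_simps)
  have i0: "(r + 2 + l) * C 2 = l * (E 2 - E 0)"
    using ge2(1) by (simp add: C_def E_def r_def)
  have i1: "(r + 3 + l) * C 3 = l * (E 3 - E 1)"
    using ge2(2) by (simp add: C_def E_def r_def eval_nat_numeral algebra_simps)
  have nz: "r + 2 + l \<noteq> 0" "r + 4 \<noteq> 0" using that by (auto simp: r_def)
  \<comment> \<open>In this order the brackets on the right vanish by \<open>c\<close>,
    \<open>i1\<close>, \<open>i0\<close>, \<open>e4\<close> and \<open>e2\<close>. The multipliers
    are chosen so that all terms except those in \<open>C 4\<close>, \<open>E 4\<close> and
    \<open>E 2\<close> cancel.\<close>
  have "(r + 2 + l) * (r + 4) * ((r + 4 + l) * C 4 - l * (E 4 - E 2)) =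
      (r + 2 + l) * (r + 4 + l) *
        ((r + 4) * C 4 - (2 * (r + 3 + l) * x * C 3 - (r + 2 + 2 * l) * C 2))
      + (r + 2 + l) * (r + 4 + l) * 2 * x * ((r + 3 + l) * C 3 - l * (E 3 - E 1))
      - (r + 4 + l) * (r + 2 + 2 * l) * ((r + 2 + l) * C 2 - l * (E 2 - E 0))
      - (r + 2 + l) * l * ((r + 4) * E 4 - (2 * (r + 4 + l) * x * E 3 - (r + 4 + 2 * l) * E 2))
      + l * (r + 4 + l) * ((r + 2) * E 2 - (2 * (r + 2 + l) * x * E 1 - (r + 2 + 2 * l) * E 0))"
    by (simp add: algebra_simps)
  also have "\<dots> = 0"
    unfolding c e4 e2 i0 i1 by simp
  finally have "(r + 2 + l) * (r + 4) * ((r + 4 + l) * C 4 - l * (E 4 - E 2)) = 0" .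
  then have "(r + 4 + l) * C 4 = l * (E 4 - E 2)"
    using nz by simp
  then show ?case
    by (simp add: C_def E_def r_def eval_nat_numeral algebra_simps)
qed

text \<open>Differentiating the recurrence leaves one undifferentiated term.
  \<open>gegenbauer_lift_param\<close> moves it to parameter \<open>l + 1\<close>, and what remains
  is the recurrence for that parameter.\<close>

lemma pderiv_gegenbauer:
  assumes "l > -1/2"
  shows "poly (pderiv (gegenbauer l (Suc n))) x = 2 * l * poly (gegenbauer (l + 1) n) x"
proof (induction n rule: induct_nat_012)
  case 0
  then show ?case by (simp add: pderiv_pCons)
next
  case 1
  then show ?case
    using poly_pderiv_gegenbauer_rec[of 0 l x]
    by (simp add: pderiv_pCons algebra_simps)
next
  case (ge2 m)
  have a: "(real m + 3) * poly (pderiv (gegenbauer l (Suc (Suc (Suc m))))) x =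
     2 * (real m + 2 + l) *
       (poly (gegenbauer l (Suc (Suc m))) x + x * (2 * l * poly (gegenbauer (l + 1) (Suc m)) x))
     - (real m + 1 + 2 * l) * (2 * l * poly (gegenbauer (l + 1) m) x)"
    using poly_pderiv_gegenbauer_rec[of "Suc m" l x] ge2 by (simp add: algebra_simps)
  have b: "(real m + 2) * poly (gegenbauer (l + 1) (Suc (Suc m))) x =
     2 * (real m + 2 + l) * x * poly (gegenbauer (l + 1) (Suc m)) x
     - (real m + 2 + 2 * l) * poly (gegenbauer (l + 1) m) x"
    using poly_gegenbauer_rec[of m "l + 1" x] by (simp add: algebra_simps)
  have c: "(real m + 2 + l) * poly (gegenbauer l (Suc (Suc m))) x =
     l * (poly (gegenbauer (l + 1) (Suc (Suc m))) x - poly (gegenbauer (l + 1) m) x)"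
    using gegenbauer_lift_param[OF assms, of m x] by simp
  have "(real m + 3) * poly (pderiv (gegenbauer l (Suc (Suc (Suc m))))) x
      = 2 * ((real m + 2 + l) * poly (gegenbauer l (Suc (Suc m))) x)
        + 2 * (real m + 2 + l) * x * (2 * l * poly (gegenbauer (l + 1) (Suc m)) x)
        - (real m + 1 + 2 * l) * (2 * l * poly (gegenbauer (l + 1) m) x)"
    unfolding a by (simp add: algebra_simps)
  also have "\<dots>
      = 2 * l * (poly (gegenbauer (l + 1) (Suc (Suc m))) x
        + (2 * (real m + 2 + l) * x * poly (gegenbauer (l + 1) (Suc m)) x
        - (real m + 2 + 2 * l) * poly (gegenbauer (l + 1) m) x))"
    unfolding c by (simp add: algebra_simps)
  also have "\<dots> = (real m + 3) * (2 * l * poly (gegenbauer (l + 1) (Suc (Suc m))) x)"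
    unfolding b[symmetric] by (simp add: algebra_simps)
  finally show ?case by simp
qed

section \<open>Generating function and maximum on \<open>[-1, 1]\<close>\<close>

lemma gcoeff_0 [simp]: "gcoeff l 0 = 1"
  by (simp add: gcoeff_def)

lemma gcoeff_Suc: "(real k + 1) * gcoeff l (Suc k) = (l + real k) * gcoeff l k"
  by (simp add: gcoeff_def pochhammer_Suc divide_simps)

text \<open>For \<open>x = joukowski w\<close> one has
  \<open>1 - 2 x t + t^2 = (1 - w t) (1 - t / w)\<close>, so the generating function is a product of
  two binomial series and the sum is their Cauchy product. A linear differential equation for this
  product reproduces the three-term recurrence.\<close>

lemma cgegenbauer_joukowski:
  assumes "w \<noteq> 0"
  shows "poly (cgegenbauer l n) (joukowski w) =
     (\<Sum>k\<le>n. of_real (gcoeff l k) * of_real (gcoeff l (n - k)) * w ^ (n - k) * inverse w ^ k)"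
proof -
  define A where "A v = Abs_fps (\<lambda>k. complex_of_real (gcoeff l k) * v ^ k)" for v
  \<comment> \<open>The logarithmic derivative of \<open>(1 - v X)\<close> to the power
    \<open>- l\<close> is \<open>l v / (1 - v X)\<close>; here it is stated without
    division.\<close>
  have A_deriv: "fps_deriv (A v) * (1 - fps_const v * fps_X) = fps_const (of_real l * v) * A v" for v
  proof (rule fps_ext)
    fix k
    show "fps_nth (fps_deriv (A v) * (1 - fps_const v * fps_X)) k =
        fps_nth (fps_const (of_real l * v) * A v) k"
    proof (cases k)
      case 0
      then show ?thesis
        using gcoeff_Suc[of 0 l] by (simp add: A_def algebra_simps)
    next
      case (Suc j)
      have "(complex_of_real (real j + 2)) * of_real (gcoeff l (Suc (Suc j)))
          = (of_real l + of_nat j + 1) * of_real (gcoeff l (Suc j))"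
        using arg_cong[OF gcoeff_Suc[of "Suc j" l], of complex_of_real] by (simp add: algebra_simps)
      moreover have "fps_nth (fps_deriv (A v) * (1 - fps_const v * fps_X)) k =
          (of_nat j + 2) * of_real (gcoeff l (Suc (Suc j))) * v ^ Suc (Suc j)
          - v * ((of_nat j + 1) * (of_real (gcoeff l (Suc j)) * v ^ Suc j))"
        by (simp add: Suc A_def right_diff_distrib mult.assoc[symmetric]) (simp add: mult_ac add_ac)
      ultimately show ?thesis
        by (simp add: Suc A_def algebra_simps)
    qed
  qed
  define F where "F = A w * A (inverse w)"
  define x where "x = joukowski w"
  have w: "fps_const w * fps_const (inverse w) = 1" using assms by simp
  have x2: "fps_const (2 * x) = fps_const w + fps_const (inverse w)"
    by (simp add: x_def joukowski_def)
  have "fps_deriv F * (1 - fps_const (2 * x) * fps_X + fps_X\<^sup>2) =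
     fps_const (of_real l) * (fps_const (2 * x) - 2 * fps_X) * F"
  proof -
    have q: "1 - fps_const (2 * x) * fps_X + fps_X\<^sup>2 =
        (1 - fps_const w * fps_X) * (1 - fps_const (inverse w) * fps_X)"
      unfolding x2 using w by (simp add: algebra_simps power2_eq_square mult.assoc[symmetric])
    have d1: "fps_deriv (A w) * (1 - fps_const w * fps_X)
        = fps_const (of_real l) * fps_const w * A w"
      using A_deriv[of w] by simp
    have d2: "fps_deriv (A (inverse w)) * (1 - fps_const (inverse w) * fps_X)
        = fps_const (of_real l) * fps_const (inverse w) * A (inverse w)"
      using A_deriv[of "inverse w"] by (simp only: fps_const_mult)
    have "fps_deriv F * ((1 - fps_const w * fps_X) * (1 - fps_const (inverse w) * fps_X))
      = fps_deriv (A w) * (1 - fps_const w * fps_X) * (A (inverse w) * (1 - fps_const (inverse w) * fps_X))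
       + fps_deriv (A (inverse w)) * (1 - fps_const (inverse w) * fps_X) * (A w * (1 - fps_const w * fps_X))"
      unfolding F_def fps_deriv_mult by (simp only: algebra_simps)
    also have "\<dots> = fps_const (of_real l) * (fps_const w + fps_const (inverse w)
        - 2 * (fps_const w * fps_const (inverse w)) * fps_X) * F"
      unfolding d1 d2 F_def by (simp only: algebra_simps mult_2 mult_2_right mult_1_left mult_1_right)
    finally show ?thesis
      unfolding q unfolding x2 w by simp
  qed
  \<comment> \<open>The constant coefficients of this equation give \<open>F1\<close>, those of
    index \<open>Suc m\<close> give the recurrence \<open>Frec\<close>.\<close>
  then have ode: "fps_deriv F - fps_const (2 * x) * (fps_X * fps_deriv F) + fps_X ^ 2 * fps_deriv F =
     fps_const (2 * of_real l * x) * F - fps_const (2 * of_real l) * (fps_X * F)"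
    by (simp add: algebra_simps numeral_fps_const flip: fps_const_mult)
  have F0: "fps_nth F 0 = 1" by (simp add: F_def A_def)
  have F1: "fps_nth F (Suc 0) = 2 * of_real l * x"
    using arg_cong[OF ode, of "\<lambda>f. fps_nth f 0"] F0 by (simp add: fps_X_power_mult_nth)
  have Frec: "(of_nat m + 2) * fps_nth F (Suc (Suc m)) =
      2 * (of_nat m + 1 + of_real l) * x * fps_nth F (Suc m) - (of_nat m + 2 * of_real l) * fps_nth F m" for m
    using arg_cong[OF ode, of "\<lambda>f. fps_nth f (Suc m)"]
    by (cases m; simp add: fps_X_power_mult_nth; simp add: algebra_simps)
  have "poly (cgegenbauer l n) x = fps_nth F n"
  proof (induction n rule: induct_nat_012)
    case (ge2 m)
    have "(of_nat m + 2) * poly (cgegenbauer l (Suc (Suc m))) x = (of_nat m + 2) * fps_nth F (Suc (Suc m))"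
      unfolding poly_cgegenbauer_rec Frec ge2 ..
    moreover have "(of_nat m + 2 :: complex) \<noteq> 0"
      by (metis of_nat_numeral of_nat_add of_nat_eq_0_iff add_is_0 zero_neq_numeral)
    ultimately show ?case by simp
  qed (use F0 F1 in \<open>auto simp: algebra_simps\<close>)
  also have "fps_nth F n = (\<Sum>i=0..n. of_real (gcoeff l i) * w ^ i *
      (of_real (gcoeff l (n - i)) * inverse w ^ (n - i)))"
    by (simp add: F_def fps_mult_nth A_def)
  also have "\<dots> = (\<Sum>k\<le>n. of_real (gcoeff l k) * of_real (gcoeff l (n - k)) * w ^ (n - k) * inverse w ^ k)"
    unfolding atMost_atLeast0
    by (subst sum.atLeastAtMost_rev) (auto intro!: sum.cong simp: algebra_simps)
  finally show ?thesis by (simp add: x_def)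
qed

lemma poly_gegenbauer_at_1: "poly (gegenbauer l n) 1 = gcoeff (2 * l) n"
proof (induction n rule: induct_nat_012)
  case (ge2 m)
  have "(real m + 2) * poly (gegenbauer l (Suc (Suc m))) 1 = (real m + 2) * gcoeff (2 * l) (Suc (Suc m))"
    using poly_gegenbauer_rec[of m l 1] ge2 gcoeff_Suc[of m "2*l"] gcoeff_Suc[of "Suc m" "2*l"]
    by (simp add: algebra_simps)
  then show ?case by simp
qed (auto simp: gcoeff_def)

lemma gcoeff_pos: "l > 0 \<Longrightarrow> gcoeff l n > 0"
  by (simp add: gcoeff_def pochhammer_pos)

text \<open>With \<open>x = joukowski w\<close> for a unit \<open>w\<close>, the polynomial becomes
  a sum of unimodular terms with coefficients that are positive because \<open>l > 0\<close>. The
  triangle inequality then yields the value at \<open>w = 1\<close>.\<close>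

lemma abs_poly_gegenbauer_le:
  assumes "l > 0" "\<bar>x\<bar> \<le> 1"
  shows "\<bar>poly (gegenbauer l n) x\<bar> \<le> gcoeff (2 * l) n"
proof -
  define w where "w = cis (arccos x)"
  have w: "w \<noteq> 0" "cmod w = 1" by (auto simp: w_def)
  have "joukowski w = complex_of_real x"
    using assms by (simp add: joukowski_def w_def cis_inverse complex_eq_iff)
  then have "\<bar>poly (gegenbauer l n) x\<bar> = cmod (poly (cgegenbauer l n) (joukowski w))"
    by (simp add: poly_cgegenbauer_of_real)
  also have "\<dots> \<le> (\<Sum>k\<le>n. cmod (of_real (gcoeff l k) * of_real (gcoeff l (n - k)) * w ^ (n - k) * inverse w ^ k))"
    unfolding cgegenbauer_joukowski[OF w(1)] by (rule norm_sum)
  also have "\<dots> = (\<Sum>k\<le>n. gcoeff l k * gcoeff l (n - k))"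
    using gcoeff_pos[OF assms(1)]
    by (intro sum.cong) (auto simp: norm_mult norm_power norm_inverse w less_imp_le)
  \<comment> \<open>The convolution identity comes from evaluating the polynomial at 1 twice: by
    \<open>cgegenbauer_joukowski\<close> with \<open>w = 1\<close>, and by
    \<open>poly_gegenbauer_at_1\<close>.\<close>
  also have "\<dots> = gcoeff (2 * l) n"
  proof -
    have "complex_of_real (\<Sum>k\<le>n. gcoeff l k * gcoeff l (n - k)) = poly (cgegenbauer l n) (joukowski 1)"
      by (subst cgegenbauer_joukowski) auto
    also have "joukowski 1 = complex_of_real 1"
      by (simp add: joukowski_def)
    finally show ?thesis
      unfolding poly_cgegenbauer_of_real poly_gegenbauer_at_1 of_real_eq_iff .
  qed
  finally show ?thesis .
qed

subsection \<open>Zeros\<close>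

lemma poly_gegenbauer_minus: "poly (gegenbauer l n) (- x) = (-1) ^ n * poly (gegenbauer l n) x"
proof (induction n rule: induct_nat_012)
  case (ge2 m)
  have "(real m + 2) * poly (gegenbauer l (Suc (Suc m))) (- x)
      = (-1) ^ m * ((real m + 2) * poly (gegenbauer l (Suc (Suc m))) x)"
    unfolding poly_gegenbauer_rec ge2 by (simp add: algebra_simps)
  then have "(real m + 2) * poly (gegenbauer l (Suc (Suc m))) (- x)
      = (real m + 2) * ((-1) ^ m * poly (gegenbauer l (Suc (Suc m))) x)"
    by (simp only: mult_ac)
  then show ?case by simp
qed auto

text \<open>The division by \<open>l\<close> makes all coefficients of the recurrence from index 3 on positive,
  also for negative \<open>l\<close>.\<close>

lemma gegenbauer_pos_right_of_1:
  assumes "l > -1/2" "l \<noteq> 0" "x \<ge> 1"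
  shows "poly (gegenbauer l (Suc m)) x / l > 0 \<and>
    (real m + 2) * (poly (gegenbauer l (Suc (Suc m))) x / l) \<ge>
    (real m + 1 + 2 * l) * (poly (gegenbauer l (Suc m)) x / l)"
proof (induction m)
  case 0
  have "poly (gegenbauer l 2) x = 2 * l * (1 + l) * x\<^sup>2 - l"
    using poly_gegenbauer_rec[of 0 l x] by (simp add: numeral_2_eq_2 algebra_simps)
  then have "2 * (poly (gegenbauer l 2) x / l) - (1 + 2 * l) * (2 * x)
      = 2 * ((x - 1) * (2 * (1 + l) * x + 1))"
    using assms by (simp add: field_simps power2_eq_square)
  moreover have "(x - 1) * (2 * (1 + l) * x + 1) \<ge> 0"
    using assms mult_nonneg_nonneg[of "2 * (1 + l)" x] by (intro mult_nonneg_nonneg) auto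
  ultimately show ?case
    using assms by (simp add: numeral_2_eq_2 algebra_simps)
next
  case (Suc m)
  define D where "D j = poly (gegenbauer l (m + j)) x / l" for j
  have rec: "(real m + 3) * D 3 = 2 * (real m + 2 + l) * x * D 2 - (real m + 1 + 2 * l) * D 1"
  proof -
    have "(real m + 3) * D 3 = (real (Suc m) + 2) * poly (gegenbauer l (Suc (Suc (Suc m)))) x / l"
      by (simp add: D_def eval_nat_numeral add_ac)
    also have "\<dots> = 2 * (real m + 2 + l) * x * D 2 - (real m + 1 + 2 * l) * D 1"
      unfolding poly_gegenbauer_rec by (simp add: D_def eval_nat_numeral add_ac diff_divide_distrib)
    finally show ?thesis .
  qed
  have IH: "D 1 > 0" "(real m + 2) * D 2 \<ge> (real m + 1 + 2 * l) * D 1"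
    using Suc by (simp_all add: D_def eval_nat_numeral)
  \<comment> \<open>The second conjunct of the induction hypothesis carries positivity from
    \<open>D 1\<close> to \<open>D 2\<close>. Inserted into \<open>rec\<close> with
    \<open>x \<ge> 1\<close>, it also reproduces itself for the next index.\<close>
  have "(real m + 1 + 2 * l) * D 1 > 0"
    using IH assms by (intro mult_pos_pos) auto
  with IH(2) have "(real m + 2) * D 2 > 0" by linarith
  then have D2: "D 2 > 0" by (simp add: zero_less_mult_iff)
  have "(real m + 2 + l) * D 2 * x \<ge> (real m + 2 + l) * D 2 * 1"
    using D2 assms by (intro mult_left_mono mult_nonneg_nonneg) auto
  then have "(real m + 3) * D 3 \<ge> (real m + 2 + 2 * l) * D 2"
    using IH rec by (simp add: algebra_simps)
  then show ?case using D2 by (simp add: D_def eval_nat_numeral algebra_simps)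
qed

lemma gegenbauer_real_root_abs_less_1:
  assumes "l > -1/2" "l \<noteq> 0" "poly (gegenbauer l (Suc m)) x = 0"
  shows "\<bar>x\<bar> < 1"
proof (rule ccontr)
  assume "\<not> \<bar>x\<bar> < 1"
  then consider "x \<ge> 1" | "- x \<ge> 1" by linarith
  then show False
  proof cases
    case 1
    then show False using gegenbauer_pos_right_of_1[of l x m] assms by simp
  next
    case 2
    then show False using gegenbauer_pos_right_of_1[of l "- x" m] assms
      by (simp add: poly_gegenbauer_minus)
  qed
qed

lemma degree_cgegenbauer:
  assumes "l > -1/2" "l \<noteq> 0"
  shows "degree (cgegenbauer l n) = n"
proof -
  have "degree (gegenbauer l n) \<le> n \<and> coeff (gegenbauer l n) n \<noteq> 0"
  proof (induction n rule: induct_nat_012)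
    case (ge2 m)
    have rec: "(real m + 2) * coeff (gegenbauer l (Suc (Suc m))) (Suc i) =
     2 * (real m + 1 + l) * coeff (gegenbauer l (Suc m)) i
     - (real m + 2 * l) * coeff (gegenbauer l m) (Suc i)" for i
      using coeff_gegenbauer_rec[of m l "Suc i"] by simp
    have "degree (gegenbauer l (Suc (Suc m))) \<le> Suc (Suc m)"
    proof (rule degree_le, safe)
      fix i assume "Suc (Suc m) < i"
      then obtain j where "i = Suc j" "Suc m < j" by (cases i) auto
      with rec[of j] ge2 show "coeff (gegenbauer l (Suc (Suc m))) i = 0"
        by (auto simp: coeff_eq_0)
    qed
    moreover have "coeff (gegenbauer l (Suc (Suc m))) (Suc (Suc m)) \<noteq> 0"
      using rec[of "Suc m"] ge2 assms by (auto simp: coeff_eq_0)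
    ultimately show ?case by simp
  qed (use assms in auto)
  then have "degree (gegenbauer l n) = n"
    by (meson le_antisym le_degree)
  then show ?thesis
    by (simp add: cgegenbauer_def degree_map_poly)
qed

text \<open>\<open>gweight\<close> is the reciprocal of the squared norm of the
  Gegenbauer polynomial, up to a factor independent of the index.\<close>

definition gweight :: "real \<Rightarrow> nat \<Rightarrow> real" where
  "gweight l k = (if k = 0 then 2 * l\<^sup>2 else (real k + l) * fact k / pochhammer (2 * l + 1) (k - 1))"

text \<open>This is \<open>gweight l n\<close> times the quotient of the leading coefficients of
  indices \<open>n\<close> and \<open>n + 1\<close>. Index 0 is separate because
  \<open>n - 1\<close> truncates there.\<close>

definition christoffel_darboux_const :: "real \<Rightarrow> nat \<Rightarrow> real" where
  "christoffel_darboux_const l n = (if n = 0 then l else fact (Suc n) / (2 * pochhammer (2 * l + 1) (n - 1)))"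

text \<open>The classical weight \<open>(k + l) k! / (2 l)_k\<close> carries an extra factor
  \<open>2 l\<close> here. It leaves a Pochhammer symbol that starts at \<open>2 l + 1 > 0\<close>,
  so the weights are positive for negative \<open>l\<close> as well.\<close>

lemma gweight_pos:
  assumes "l > -1/2" "l \<noteq> 0"
  shows "gweight l k > 0"
  using assms by (cases k) (auto simp: gweight_def intro!: divide_pos_pos mult_pos_pos pochhammer_pos)

lemma gweight_eq:
  assumes "l > -1/2" "l \<noteq> 0"
  shows "gweight l k * (real k + 1) = 2 * (real k + l) * christoffel_darboux_const l k"
proof (cases k)
  case (Suc j)
  have "pochhammer (2 * l + 1) j > 0" using assms by (intro pochhammer_pos) auto
  then show ?thesis
    by (simp add: Suc gweight_def christoffel_darboux_const_def divide_simps) (simp add: algebra_simps)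
qed (simp add: gweight_def christoffel_darboux_const_def power2_eq_square)

lemma christoffel_darboux_const_Suc:
  assumes "l > -1/2" "l \<noteq> 0"
  shows "christoffel_darboux_const l (Suc k) * (real k + 2 * l) = christoffel_darboux_const l k * (real k + 2)"
proof (cases k)
  case 0
  then show ?thesis by (simp add: christoffel_darboux_const_def fact_numeral numeral_2_eq_2)
next
  case (Suc j)
  have "pochhammer (2 * l + 1) j > 0" using assms by (intro pochhammer_pos) auto
  moreover have "2 * l + 1 + real j > 0" using assms by auto
  ultimately show ?thesis
    by (simp add: Suc christoffel_darboux_const_def pochhammer_Suc divide_simps)
qed

text \<open>Multiplying the recurrence at \<open>x\<close> by the value at \<open>y\<close> and
  antisymmetrising makes the sum telescope. A conjugate pair of arguments yields that zeros are
  real; differentiation at \<open>x = y\<close> yields that they are simple.\<close>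

lemma gegenbauer_Christoffel_Darboux:
  assumes "l > -1/2" "l \<noteq> 0"
  shows "(x - y) * (\<Sum>k\<le>n. of_real (gweight l k) * poly (cgegenbauer l k) x * poly (cgegenbauer l k) y) =
    of_real (christoffel_darboux_const l n) *
      (poly (cgegenbauer l (Suc n)) x * poly (cgegenbauer l n) y
       - poly (cgegenbauer l n) x * poly (cgegenbauer l (Suc n)) y)"
proof (induction n)
  case 0
  then show ?case by (simp add: gweight_def christoffel_darboux_const_def power2_eq_square algebra_simps)
next
  case (Suc n)
  define W where "W = complex_of_real (gweight l (Suc n))"
  define K where "K = complex_of_real (christoffel_darboux_const l n)"
  define K' where "K' = complex_of_real (christoffel_darboux_const l (Suc n))"
  define L where "L = complex_of_real l"
  define N where "N = (of_nat n :: complex)"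
  define a where "a j = poly (cgegenbauer l (n + j)) x" for j
  define b where "b j = poly (cgegenbauer l (n + j)) y" for j
  have W: "W * (N + 2) = 2 * (N + 1 + L) * K'"
    using arg_cong[OF gweight_eq[OF assms, of "Suc n"], of complex_of_real]
    by (simp add: W_def K'_def L_def N_def algebra_simps)
  have K': "K' * (N + 2 * L) = K * (N + 2)"
    using arg_cong[OF christoffel_darboux_const_Suc[OF assms, of n], of complex_of_real]
    by (simp add: K_def K'_def L_def N_def algebra_simps)
  have ra: "(N + 2) * a 2 = 2 * (N + 1 + L) * x * a 1 - (N + 2 * L) * a 0"
    using poly_cgegenbauer_rec[of n l x] by (simp add: a_def N_def L_def numeral_2_eq_2)
  have rb: "(N + 2) * b 2 = 2 * (N + 1 + L) * y * b 1 - (N + 2 * L) * b 0"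
    using poly_cgegenbauer_rec[of n l y] by (simp add: b_def N_def L_def numeral_2_eq_2)
  have nz: "N + 2 \<noteq> 0"
    unfolding N_def by (metis of_nat_numeral of_nat_add of_nat_eq_0_iff add_is_0 zero_neq_numeral)
  have "(N + 2) * ((x - y) * (W * a 1 * b 1) + K * (a 1 * b 0 - a 0 * b 1)) =
      (x - y) * a 1 * b 1 * (W * (N + 2)) + (K * (N + 2)) * (a 1 * b 0 - a 0 * b 1)"
    by (simp add: algebra_simps)
  also have "\<dots> = K' * ((2 * (N + 1 + L) * x * a 1 - (N + 2 * L) * a 0) * b 1
      - a 1 * (2 * (N + 1 + L) * y * b 1 - (N + 2 * L) * b 0))"
    unfolding W K'[symmetric] by (simp add: algebra_simps)
  also have "\<dots> = (N + 2) * (K' * (a 2 * b 1 - a 1 * b 2))"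
    unfolding ra[symmetric] rb[symmetric] by (simp add: algebra_simps)
  finally have "(x - y) * (W * a 1 * b 1) + K * (a 1 * b 0 - a 0 * b 1)
      = K' * (a 2 * b 1 - a 1 * b 2)"
    using nz by simp
  then show ?case
    using Suc by (simp add: a_def b_def W_def K_def K'_def numeral_2_eq_2 distrib_left add.commute)
qed

lemma gegenbauer_kernel_pos:
  assumes "l > -1/2" "l \<noteq> 0"
  shows "(\<Sum>k\<le>n. of_real (gweight l k) * poly (cgegenbauer l k) z * cnj (poly (cgegenbauer l k) z)) \<noteq> 0"
proof -
  have "(\<Sum>k\<le>n. gweight l k * (cmod (poly (cgegenbauer l k) z))\<^sup>2) > 0"
  proof (rule sum_pos2[of _ 0])
    show "gweight l 0 * (cmod (poly (cgegenbauer l 0) z))\<^sup>2 > 0"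
      using gweight_pos[OF assms, of 0] by simp
  qed (use gweight_pos[OF assms] in \<open>auto simp: less_imp_le\<close>)
  moreover have "(\<Sum>k\<le>n. of_real (gweight l k) * poly (cgegenbauer l k) z * cnj (poly (cgegenbauer l k) z))
      = complex_of_real (\<Sum>k\<le>n. gweight l k * (cmod (poly (cgegenbauer l k) z))\<^sup>2)"
    by (simp add: mult.assoc flip: complex_norm_square of_real_power)
  ultimately show ?thesis
    by (metis less_irrefl of_real_eq_0_iff)
qed

lemma poly_cgegenbauer_cnj: "poly (cgegenbauer l n) (cnj z) = cnj (poly (cgegenbauer l n) z)"
proof -
  have "poly (map_poly complex_of_real p) (cnj z) = cnj (poly (map_poly complex_of_real p) z)" for p
    by (induction p) (auto simp: map_poly_pCons)
  then show ?thesis by (simp add: cgegenbauer_def)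
qed

text \<open>The coefficients are real, so \<open>cnj z\<close> is a zero too and the right side of
  Christoffel-Darboux vanishes at \<open>z\<close> and \<open>cnj z\<close>. The kernel is a sum of
  weighted squared moduli and does not vanish, which forces \<open>z = cnj z\<close>.\<close>

lemma cgegenbauer_root_real:
  assumes "l > -1/2" "l \<noteq> 0" "poly (cgegenbauer l (Suc n)) z = 0"
  shows "z \<in> \<real>"
proof -
  have "poly (cgegenbauer l (Suc n)) (cnj z) = 0"
    using assms by (simp add: poly_cgegenbauer_cnj)
  then have "(z - cnj z) * (\<Sum>k\<le>n. of_real (gweight l k) * poly (cgegenbauer l k) z * cnj (poly (cgegenbauer l k) z)) = 0"
    using gegenbauer_Christoffel_Darboux[OF assms(1,2), of z "cnj z" n] assms
    by (simp add: poly_cgegenbauer_cnj)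
  then have "z = cnj z"
    using gegenbauer_kernel_pos[OF assms(1,2)] by simp
  then show ?thesis by (metis Reals_cnj_iff)
qed

lemma cgegenbauer_root_obtains:
  assumes "l > -1/2" "l \<noteq> 0" "poly (cgegenbauer l (Suc n)) z = 0"
  obtains x where "z = complex_of_real x" "\<bar>x\<bar> < 1" "poly (gegenbauer l (Suc n)) x = 0"
proof -
  obtain x where x: "z = complex_of_real x"
    using cgegenbauer_root_real[OF assms] by (auto elim: Reals_cases)
  with assms have "poly (gegenbauer l (Suc n)) x = 0"
    by (simp add: poly_cgegenbauer_of_real)
  with gegenbauer_real_root_abs_less_1[OF assms(1,2)] x that show ?thesis by blast
qed

text \<open>With \<open>y\<close> fixed at the zero \<open>r\<close>, Christoffel-Darboux says that
  \<open>[:- r, 1:] * S\<close> is a multiple of the polynomial of index \<open>n + 1\<close>. At a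
  double zero, differentiating gives \<open>poly S r = 0\<close>, against the positivity of the
  kernel at the real point \<open>r\<close>.\<close>

lemma cgegenbauer_root_simple:
  assumes l: "l > -1/2" "l \<noteq> 0" and root: "poly (cgegenbauer l (Suc n)) r = 0"
  shows "poly (pderiv (cgegenbauer l (Suc n))) r \<noteq> 0"
proof
  assume deriv0: "poly (pderiv (cgegenbauer l (Suc n))) r = 0"
  define S where "S = (\<Sum>k\<le>n. smult (of_real (gweight l k) * poly (cgegenbauer l k) r) (cgegenbauer l k))"
  define K where "K = complex_of_real (christoffel_darboux_const l n)"
  have "[:- r, 1:] * S = smult (K * poly (cgegenbauer l n) r) (cgegenbauer l (Suc n))
      - smult (K * poly (cgegenbauer l (Suc n)) r) (cgegenbauer l n)"
  proof (rule poly_ext)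
    fix x
    show "poly ([:- r, 1:] * S) x = poly (smult (K * poly (cgegenbauer l n) r) (cgegenbauer l (Suc n))
      - smult (K * poly (cgegenbauer l (Suc n)) r) (cgegenbauer l n)) x"
      using gegenbauer_Christoffel_Darboux[OF l, of x r n]
      by (simp add: S_def K_def poly_sum algebra_simps)
  qed
  then have "poly (pderiv ([:- r, 1:] * S)) r = 0"
    using root deriv0 by (simp add: pderiv_diff pderiv_smult)
  then have "poly S r = 0"
    by (simp add: pderiv_mult pderiv_pCons del: mult_pCons_left)
  moreover have "r \<in> \<real>" by (rule cgegenbauer_root_real[OF l root])
  then have "cnj (poly (cgegenbauer l k) r) = poly (cgegenbauer l k) r" for k
    by (metis Reals_cnj_iff poly_cgegenbauer_cnj)
  ultimately show False
    using gegenbauer_kernel_pos[OF l, where n = n and z = r] by (simp add: S_def poly_sum mult_ac)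
qed

text \<open>Simplicity makes the number of complex zeros equal to the degree, and all of them are
  real.\<close>

lemma card_gauss_points:
  assumes l: "l > -1/2" "l \<noteq> 0"
  shows "card (gegenbauer_gauss_points l n) = Suc n" "finite (gegenbauer_gauss_points l n)"
proof -
  let ?P = "cgegenbauer l (Suc n)"
  have "?P \<noteq> 0" using degree_cgegenbauer[OF l, of "Suc n"] by auto
  have rs: "rsquarefree ?P"
    unfolding rsquarefree_roots using cgegenbauer_root_simple[OF l] by blast
  have "card {z. poly ?P z = 0} = Suc n"
  proof -
    have "degree ?P = degree (\<Prod>z | poly ?P z = 0. [:- z, 1:])"
      using complex_poly_decompose_rsquarefree[OF rs] \<open>?P \<noteq> 0\<close>
      by (metis degree_smult_eq leading_coeff_0_iff)
    also have "\<dots> = card {z. poly ?P z = 0}"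
      by (subst degree_prod_sum_eq) auto
    finally show ?thesis using degree_cgegenbauer[OF l] by simp
  qed
  moreover have "{z. poly ?P z = 0} = complex_of_real ` gegenbauer_gauss_points l n"
    by (auto simp: gegenbauer_gauss_points_def poly_cgegenbauer_of_real
        elim: cgegenbauer_root_obtains[OF l])
  ultimately show "card (gegenbauer_gauss_points l n) = Suc n"
    by (simp add: card_image inj_on_def)
  \<comment> \<open>An infinite set has cardinality 0, so a positive cardinality implies
    finiteness.\<close>
  then show "finite (gegenbauer_gauss_points l n)"
    by (intro card_ge_0_finite) auto
qed

subsection \<open>The interpolation error\<close>

lemma contour_integrable_continuous_C1:
  assumes "\<And>t. t \<in> {0..1} \<Longrightarrow> (\<gamma> has_vector_derivative \<gamma>' t) (at t)" "continuous_on {0..1} \<gamma>'"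
    and "valid_path \<gamma>" "continuous_on (path_image \<gamma>) f"
  shows "f contour_integrable_on \<gamma>"
proof -
  have "continuous_on {0..1} (\<lambda>t. f (\<gamma> t) * \<gamma>' t)"
    using assms(2) valid_path_imp_path[OF assms(3)] assms(4)
    by (auto intro!: continuous_intros continuous_on_compose2[OF assms(4)]
        simp: path_def path_image_def)
  then have "(\<lambda>t. f (\<gamma> t) * \<gamma>' t) integrable_on {0..1}"
    by (rule integrable_continuous_interval)
  then show ?thesis
    unfolding contour_integrable_on
    by (rule integrable_eq) (simp add: vector_derivative_at[OF assms(1)])
qed

text \<open>Cauchy's formula is split by \<open>poly P w = poly P z + (poly P w - poly P z)\<close>.
  The first part is the remainder \<open>poly P z * G z\<close>, the second is a polynomial
  \<open>q\<close> in \<open>z\<close> of degree below that of \<open>P\<close>. At the nodes the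
  remainder vanishes, so \<open>q\<close> is the interpolant.\<close>

lemma deriv_interpolation_error:
  fixes u :: "complex \<Rightarrow> complex" and P p :: "complex poly"
  assumes S: "convex S" "u holomorphic_on S"
    and \<gamma>: "valid_path \<gamma>" "pathfinish \<gamma> = pathstart \<gamma>" "path_image \<gamma> \<subseteq> S"
    and \<gamma>': "\<And>t. t \<in> {0..1} \<Longrightarrow> (\<gamma> has_vector_derivative \<gamma>' t) (at t)" "continuous_on {0..1} \<gamma>'"
    and T: "open T" "T \<subseteq> interior S" "T \<inter> path_image \<gamma> = {}"
    and winding: "\<And>z. z \<in> T \<Longrightarrow> winding_number \<gamma> z = 1"
    and P: "\<And>z. z \<in> path_image \<gamma> \<Longrightarrow> poly P z \<noteq> 0"
    and A: "A \<subseteq> T" "card A = degree P" "\<And>z. z \<in> A \<Longrightarrow> poly P z = 0"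
    and p: "degree p < degree P" "\<And>z. z \<in> A \<Longrightarrow> poly p z = u z"
    and a: "a \<in> A"
  shows "deriv (\<lambda>z. u z - poly p z) a =
    poly (pderiv P) a / (2 * pi * \<i>) * contour_integral \<gamma> (\<lambda>z. u z / (poly P z * (z - a)))"
proof -
  define n where "n = degree P"
  define v where "v z = u z / poly P z" for z
  define G where "G z = contour_integral \<gamma> (\<lambda>w. v w / (w - z))" for z
  \<comment> \<open>\<open>c j w\<close> is the coefficient of \<open>z ^ j\<close> in the divided
    difference \<open>(poly P w - poly P z) / (w - z)\<close>; integrating it against
    \<open>v\<close> gives the coefficients of \<open>q\<close>.\<close>
  define c where "c j w = (\<Sum>k=Suc j..n. coeff P k * w ^ (k - Suc j))" for j w
  define q where "q = (\<Sum>j<n. monom (contour_integral \<gamma> (\<lambda>w. v w * c j w) / (2 * pi * \<i>)) j)"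
  have cont_u: "continuous_on (path_image \<gamma>) u"
    using S(2) \<gamma>(3) holomorphic_on_imp_continuous_on holomorphic_on_subset by blast
  have cont_v: "continuous_on (path_image \<gamma>) v"
    unfolding v_def using P by (intro continuous_intros cont_u) auto
  note integrable = contour_integrable_continuous_C1[OF \<gamma>' \<gamma>(1)]
  have int_v: "(\<lambda>w. v w / (w - z)) contour_integrable_on \<gamma>" if "z \<in> T" for z
    using that T by (intro integrable continuous_intros cont_v) auto
  have int_c: "(\<lambda>w. v w * c j w) contour_integrable_on \<gamma>" for j
    unfolding c_def by (intro integrable continuous_intros cont_v)
  have split: "poly P w - poly P z = (w - z) * (\<Sum>j<n. c j w * z ^ j)" for w z
  proof -
    have "poly P z - poly P w = (z - w) * (\<Sum>j<n. c j w * z ^ j)"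
      unfolding poly_altdef n_def[symmetric] sub_polyfun c_def sum_distrib_right ..
    then show ?thesis by (simp add: algebra_simps)
  qed
  have rep: "u z - poly q z = poly P z * G z / (2 * pi * \<i>)" if z: "z \<in> T" for z
  proof -
    have "((\<lambda>w. u w / (w - z)) has_contour_integral (2 * pi * \<i> * winding_number \<gamma> z * u z)) \<gamma>"
      using z T \<gamma> by (intro Cauchy_integral_formula_convex_simple[OF S]) auto
    then have "2 * pi * \<i> * u z = contour_integral \<gamma> (\<lambda>w. u w / (w - z))"
      using winding[OF z] by (simp add: contour_integral_unique)
    also have "\<dots> = contour_integral \<gamma> (\<lambda>w. poly P z * (v w / (w - z)) + (\<Sum>j<n. z ^ j * (v w * c j w)))"
    proof (rule contour_integral_cong)
      fix w assume w: "w \<in> path_image \<gamma>"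
      with z T have "w \<noteq> z" by auto
      have "u w / (w - z) = v w * (poly P z + (poly P w - poly P z)) / (w - z)"
        using P[OF w] by (simp add: v_def)
      also have "\<dots> = poly P z * (v w / (w - z)) + v w * (\<Sum>j<n. c j w * z ^ j)"
        unfolding split using \<open>w \<noteq> z\<close> by (simp add: field_simps)
      also have "v w * (\<Sum>j<n. c j w * z ^ j) = (\<Sum>j<n. z ^ j * (v w * c j w))"
        by (simp add: sum_distrib_left mult_ac)
      finally show "u w / (w - z) = poly P z * (v w / (w - z)) + (\<Sum>j<n. z ^ j * (v w * c j w))" .
    qed simp
    also have "\<dots> = poly P z * G z + (\<Sum>j<n. z ^ j * contour_integral \<gamma> (\<lambda>w. v w * c j w))"
    proof -
      have int_sum: "(\<lambda>w. \<Sum>j<n. z ^ j * (v w * c j w)) contour_integrable_on \<gamma>"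
        by (intro contour_integrable_sum contour_integrable_lmul int_c) simp
      show ?thesis
        unfolding G_def contour_integral_add[OF contour_integrable_lmul[OF int_v[OF z]] int_sum]
          contour_integral_lmul[OF int_v[OF z]]
        by (subst contour_integral_sum)
          (simp_all add: contour_integrable_lmul contour_integral_lmul int_c)
    qed
    also have "(\<Sum>j<n. z ^ j * contour_integral \<gamma> (\<lambda>w. v w * c j w)) = 2 * pi * \<i> * poly q z"
      by (simp add: q_def poly_sum poly_monom sum_distrib_left mult_ac)
    finally have "2 * pi * \<i> * (u z - poly q z) = poly P z * G z"
      by (simp add: algebra_simps)
    then show ?thesis by (simp add: field_simps)
  qed
  have "degree q < degree P"
  proof -
    have "n > 0" using p(1) n_def by simp
    then show ?thesis
      unfolding q_def n_def[symmetric]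
      by (intro degree_sum_less) (auto intro: le_less_trans[OF degree_monom_le])
  qed
  have "q = p"
  proof (rule poly_eqI_degree)
    show "poly q z = poly p z" if "z \<in> A" for z
      using rep[of z] that A p by auto
  qed (use A p \<open>degree q < degree P\<close> in auto)
  have "a \<in> T" using a A by auto
  have "bounded (\<gamma>' ` {0..1})"
    by (rule compact_imp_bounded[OF compact_continuous_image[OF \<gamma>'(2)]]) simp
  then obtain B where B: "\<forall>x\<in>\<gamma>' ` {0..1}. norm x \<le> B"
    unfolding bounded_iff by blast
  have bound: "norm (vector_derivative \<gamma> (at t)) \<le> B" if "t \<in> {0..1}" for t
    unfolding vector_derivative_at[OF \<gamma>'(1)[OF that]] using B that by blast
  \<comment> \<open>In the product rule \<open>G'\<close> is multiplied by \<open>poly P a\<close>,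
    which is 0, so its existence suffices.\<close>
  obtain G' where G': "(G has_field_derivative G') (at a)"
  proof -
    have "((\<lambda>w. v w / (w - z) ^ 1) has_contour_integral G z) \<gamma>" if "z \<in> T - path_image \<gamma>" for z
      using int_v[of z] that by (simp add: G_def has_contour_integral_integral)
    then show ?thesis
      using Cauchy_next_derivative(2)[OF cont_v bound, of T 1 G a] that \<gamma>(1) T \<open>a \<in> T\<close> by auto
  qed
  have "((\<lambda>z. poly P z * G z / (2 * pi * \<i>)) has_field_derivative
      (poly (pderiv P) a * G a + poly P a * G') / (2 * pi * \<i>)) (at a)"
    using DERIV_cdivide[OF DERIV_mult[OF poly_DERIV[of P a] G'], of "2 * pi * \<i>"]
    by (simp add: mult.commute)
  then have "((\<lambda>z. u z - poly p z) has_field_derivative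
      (poly (pderiv P) a * G a + poly P a * G') / (2 * pi * \<i>)) (at a)"
    by (rule has_field_derivative_transform_within_open[OF _ T(1) \<open>a \<in> T\<close>])
      (use rep \<open>q = p\<close> in simp)
  then have "deriv (\<lambda>z. u z - poly p z) a = poly (pderiv P) a / (2 * pi * \<i>) * G a"
    using A(3)[OF a] by (simp add: DERIV_imp_deriv)
  also have "G a = contour_integral \<gamma> (\<lambda>z. u z / (poly P z * (z - a)))"
    by (simp add: G_def v_def)
  finally show ?thesis .
qed

section \<open>The ellipse as a level set of the sum of focal distances\<close>

text \<open>Both focal distances are squares, \<open>joukowski w - 1 = (w - 1)^2 / (2 w)\<close> and
  likewise with plus, so the parallelogram law adds them up.\<close>

lemma norm_joukowski_foci:
  assumes "w \<noteq> 0"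
  shows "cmod (joukowski w - 1) + cmod (joukowski w + 1) = cmod w + 1 / cmod w"
proof -
  have "joukowski w - 1 = (w - 1)\<^sup>2 / (2 * w)" "joukowski w + 1 = (w + 1)\<^sup>2 / (2 * w)"
    using assms by (simp_all add: joukowski_def field_simps power2_eq_square)
  then have "cmod (joukowski w - 1) + cmod (joukowski w + 1)
      = ((cmod (w - 1))\<^sup>2 + (cmod (w + 1))\<^sup>2) / (2 * cmod w)"
    by (simp add: norm_divide norm_power norm_mult add_divide_distrib)
  also have "(cmod (w - 1))\<^sup>2 + (cmod (w + 1))\<^sup>2 = 2 * (cmod w)\<^sup>2 + 2"
    unfolding cmod_power2 by (simp add: power2_eq_square algebra_simps)
  also have "\<dots> / (2 * cmod w) = cmod w + 1 / cmod w"
    using assms by (simp add: field_simps power2_eq_square)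
  finally show ?thesis .
qed

lemma joukowski_inverse: "joukowski (inverse w) = joukowski w"
  by (simp add: joukowski_def)

text \<open>The two solutions \<open>z + s\<close> and \<open>z - s\<close> have product 1, so one
  of them has modulus at least 1.\<close>

lemma joukowski_surj:
  obtains w where "cmod w \<ge> 1" "joukowski w = z"
proof -
  define s where "s = csqrt (z\<^sup>2 - 1)"
  have s: "s\<^sup>2 = z\<^sup>2 - 1" by (simp add: s_def)
  have prod: "(z + s) * (z - s) = 1" using s by (simp add: algebra_simps power2_eq_square)
  then have "inverse (z + s) = z - s" by (metis inverse_unique)
  then have J: "joukowski (z + s) = z" by (simp add: joukowski_def)
  show ?thesis
  proof (cases "cmod (z + s) \<ge> 1")
    case True
    with J that show ?thesis by blast
  next
    case False
    have "z + s \<noteq> 0" using prod by auto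
    with False have "cmod (inverse (z + s)) \<ge> 1"
      by (simp add: norm_inverse one_le_inverse)
    with J that joukowski_inverse show ?thesis by metis
  qed
qed

lemma bernstein_ellipse_eq_image:
  assumes "\<rho> > 1"
  shows "bernstein_ellipse \<rho> = joukowski ` sphere 0 \<rho>"
proof (intro equalityI subsetI)
  fix z assume "z \<in> bernstein_ellipse \<rho>"
  then obtain \<theta> where "z = joukowski (complex_of_real \<rho> * exp (\<i> * complex_of_real \<theta>))"
    by (auto simp: bernstein_ellipse_def joukowski_def)
  then show "z \<in> joukowski ` sphere 0 \<rho>"
    using assms by (auto simp: norm_mult)
next
  fix z assume "z \<in> joukowski ` sphere 0 \<rho>"
  then obtain w where w: "cmod w = \<rho>" "z = joukowski w" by auto
  have "w = complex_of_real \<rho> * exp (\<i> * complex_of_real (Arg2pi w))"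
    using Arg2pi_eq[of w] w by simp
  moreover have "Arg2pi w \<in> {0..2 * pi}"
    using Arg2pi_ge_0[of w] Arg2pi_lt_2pi[of w] by simp
  ultimately show "z \<in> bernstein_ellipse \<rho>"
    unfolding bernstein_ellipse_def using w joukowski_def by blast
qed

text \<open>Sublevel sets of this continuous convex function stand in for the region bounded by the
  ellipse: openness, convexity and the position of the nodes can be read off from it.\<close>

definition foci_sum :: "complex \<Rightarrow> real" where
  "foci_sum z = cmod (z - 1) + cmod (z + 1)"

lemma add_inverse_less_iff:
  fixes r s :: real
  assumes "r \<ge> 1" "s > 1"
  shows "r + 1 / r < s + 1 / s \<longleftrightarrow> r < s"
proof -
  have "r * s > 1" using mult_mono[of 1 r s s] assms by linarith
  have "s + 1 / s - (r + 1 / r) = (s - r) * (r * s - 1) / (r * s)"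
    using assms by (simp add: field_simps)
  with \<open>r * s > 1\<close> show ?thesis
    by (smt (verit) divide_pos_pos divide_nonpos_pos mult_pos_pos mult_nonpos_nonneg)
qed

lemma bernstein_ellipse_eq:
  assumes "\<rho> > 1"
  shows "bernstein_ellipse \<rho> = {z. foci_sum z = \<rho> + 1 / \<rho>}"
proof (intro equalityI subsetI)
  fix z assume "z \<in> bernstein_ellipse \<rho>"
  then obtain w where "cmod w = \<rho>" "z = joukowski w"
    using assms by (auto simp: bernstein_ellipse_eq_image)
  then show "z \<in> {z. foci_sum z = \<rho> + 1 / \<rho>}"
    using norm_joukowski_foci[of w] assms by (cases "w = 0") (auto simp: foci_sum_def)
next
  fix z assume z: "z \<in> {z. foci_sum z = \<rho> + 1 / \<rho>}"
  obtain w where w: "cmod w \<ge> 1" "joukowski w = z" by (rule joukowski_surj)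
  then have "cmod w + 1 / cmod w = \<rho> + 1 / \<rho>"
    using norm_joukowski_foci[of w] z by (cases "w = 0") (auto simp: foci_sum_def)
  then have "cmod w = \<rho>"
    \<comment> \<open>With its arguments exchanged, \<open>add_inverse_less_iff\<close> requires
      \<open>cmod w > 1\<close>; hence the separate case of modulus 1.\<close>
    using add_inverse_less_iff[of "cmod w" \<rho>] add_inverse_less_iff[of \<rho> "cmod w"] w assms
    by (cases "cmod w = 1") auto
  then show "z \<in> bernstein_ellipse \<rho>"
    using w by (auto simp: bernstein_ellipse_eq_image[OF assms])
qed

lemma continuous_on_foci_sum [continuous_intros]: "continuous_on A foci_sum"
  unfolding foci_sum_def by (intro continuous_intros)

text \<open>By the intermediate value theorem a component of the complement cannot leave the
  sublevel set without meeting the ellipse. The sublevel set is bounded, so the component is. This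
  carries analyticity from \<open>inside\<close> to the sublevel set.\<close>

lemma foci_sum_sublevel_subset_inside:
  assumes "\<rho> > 1"
  shows "{z. foci_sum z < \<rho> + 1 / \<rho>} \<subseteq> inside (bernstein_ellipse \<rho>)"
proof
  fix z assume "z \<in> {z. foci_sum z < \<rho> + 1 / \<rho>}"
  then have z: "foci_sum z < \<rho> + 1 / \<rho>" by simp
  let ?C = "connected_component_set (- bernstein_ellipse \<rho>) z"
  have zE: "z \<notin> bernstein_ellipse \<rho>" using z by (simp add: bernstein_ellipse_eq[OF assms])
  have "?C \<subseteq> {z. foci_sum z < \<rho> + 1 / \<rho>}"
  proof (rule ccontr)
    assume "\<not> ?thesis"
    then obtain y where y: "y \<in> ?C" "foci_sum y \<ge> \<rho> + 1 / \<rho>" by (metis mem_Collect_eq not_less subsetI)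
    have "connected (foci_sum ` ?C)"
      by (intro connected_continuous_image continuous_intros) simp
    moreover have "z \<in> ?C" using zE by simp
    ultimately have "\<rho> + 1 / \<rho> \<in> foci_sum ` ?C"
      using connectedD_interval[of "foci_sum ` ?C" "foci_sum z" "foci_sum y" "\<rho> + 1 / \<rho>"] y z by auto
    then obtain x where "x \<in> ?C" "foci_sum x = \<rho> + 1 / \<rho>" by auto
    moreover have "?C \<subseteq> - bernstein_ellipse \<rho>" by (rule connected_component_subset)
    ultimately show False by (auto simp: bernstein_ellipse_eq[OF assms])
  qed
  moreover have "bounded {z. foci_sum z < \<rho> + 1 / \<rho>}"
  proof (rule boundedI)
    fix x assume "x \<in> {z. foci_sum z < \<rho> + 1 / \<rho>}"
    then have "cmod (x - 1) + cmod (x + 1) < \<rho> + 1 / \<rho>" by (simp add: foci_sum_def)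
    moreover have "cmod x \<le> cmod (x - 1) + 1" using norm_triangle_ineq[of "x - 1" 1] by simp
    moreover have "cmod (x + 1) \<ge> 0" by simp
    ultimately show "norm x \<le> \<rho> + 1 / \<rho> + 1" by linarith
  qed
  ultimately have "bounded ?C" by (rule bounded_subset[rotated])
  then show "z \<in> inside (bernstein_ellipse \<rho>)"
    using zE by (simp add: inside_def)
qed

text \<open>A sum of two distances to fixed points is convex. The Cauchy formula used above is the
  one for convex domains.\<close>

lemma convex_foci_sum_sublevel: "convex {z. foci_sum z \<le> c}"
proof -
  have "foci_sum (s *\<^sub>R x + t *\<^sub>R y) \<le> c"
    if "foci_sum x \<le> c" "foci_sum y \<le> c" "s \<ge> 0" "t \<ge> 0" "s + t = 1" for x y s t
  proof -
    have *: "cmod (s *\<^sub>R x + t *\<^sub>R y - e) \<le> s * cmod (x - e) + t * cmod (y - e)" for e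
    proof -
      have "s *\<^sub>R x + t *\<^sub>R y - e = s *\<^sub>R (x - e) + t *\<^sub>R (y - e)"
        using that(5) by (simp add: algebra_simps flip: scaleR_add_left)
      also have "cmod \<dots> \<le> s * cmod (x - e) + t * cmod (y - e)"
        using norm_triangle_ineq[of "s *\<^sub>R (x - e)" "t *\<^sub>R (y - e)"] that by simp
      finally show ?thesis .
    qed
    have "foci_sum (s *\<^sub>R x + t *\<^sub>R y) \<le> s * foci_sum x + t * foci_sum y"
      using *[of 1] *[of "-1"] by (simp add: foci_sum_def algebra_simps)
    also have "\<dots> \<le> s * c + t * c"
      using that by (intro add_mono mult_left_mono) auto
    also have "\<dots> = c" using that(5) by (simp flip: distrib_right)
    finally show ?thesis .
  qed
  then show ?thesis by (auto simp: convex_def)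
qed

section \<open>Parametrisation, arc length and winding number\<close>

definition ellipse_path :: "real \<Rightarrow> real \<Rightarrow> complex" where
  "ellipse_path \<rho> = joukowski \<circ> circlepath 0 \<rho>"

lemma has_field_derivative_joukowski:
  assumes "w \<noteq> 0"
  shows "(joukowski has_field_derivative (1 - 1 / w\<^sup>2) / 2) (at w)"
proof -
  have J: "joukowski = (\<lambda>w. (w + inverse w) / 2)"
    by (simp add: fun_eq_iff joukowski_def)
  have "- (inverse w ^ Suc (Suc 0)) = - (1 / w\<^sup>2)"
    by (simp add: power2_eq_square divide_inverse)
  from DERIV_cdivide[OF DERIV_add[OF DERIV_ident DERIV_inverse[OF assms]], of 2, unfolded this]
  show ?thesis unfolding J by simp
qed

lemma holomorphic_joukowski: "joukowski holomorphic_on - {0}"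
  unfolding joukowski_def by (intro holomorphic_intros) auto

lemma path_image_ellipse_path:
  assumes "\<rho> > 1"
  shows "path_image (ellipse_path \<rho>) = bernstein_ellipse \<rho>"
  using assms by (simp add: ellipse_path_def path_image_compose bernstein_ellipse_eq_image)

lemma valid_path_ellipse_path: "\<rho> > 1 \<Longrightarrow> valid_path (ellipse_path \<rho>)"
  unfolding ellipse_path_def
  by (rule valid_path_compose_holomorphic[OF _ holomorphic_joukowski]) auto

lemma closed_ellipse_path: "pathfinish (ellipse_path \<rho>) = pathstart (ellipse_path \<rho>)"
  by (simp add: ellipse_path_def pathfinish_compose pathstart_compose)

text \<open>By the chain rule this is \<open>2 pi i w\<close> times the derivative
  \<open>(1 - 1 / w^2) / 2\<close> of \<open>joukowski\<close>.\<close>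

definition ellipse_velocity :: "real \<Rightarrow> real \<Rightarrow> complex" where
  "ellipse_velocity \<rho> t = (let w = circlepath 0 \<rho> t in pi * \<i> * (w - 1 / w))"

lemma has_vector_derivative_ellipse_path:
  assumes "\<rho> > 1"
  shows "(ellipse_path \<rho> has_vector_derivative ellipse_velocity \<rho> t) (at t)"
proof -
  define w where "w = circlepath 0 \<rho> t"
  have "w \<noteq> 0" using assms by (simp add: w_def circlepath)
  have "(circlepath 0 \<rho> has_vector_derivative 2 * pi * \<i> * w) (at t)"
    unfolding w_def using has_vector_derivative_circlepath[of 0 \<rho> t UNIV] by (simp add: circlepath mult_ac)
  then have "(joukowski \<circ> circlepath 0 \<rho> has_vector_derivative 2 * pi * \<i> * w * ((1 - 1 / w\<^sup>2) / 2)) (at t)"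
    using has_field_derivative_joukowski[OF \<open>w \<noteq> 0\<close>] by (intro field_vector_diff_chain_at) (simp_all add: w_def)
  also have "2 * pi * \<i> * w * ((1 - 1 / w\<^sup>2) / 2) = ellipse_velocity \<rho> t"
    using \<open>w \<noteq> 0\<close> by (simp add: ellipse_velocity_def w_def[symmetric] field_simps power2_eq_square)
  finally show ?thesis by (simp add: ellipse_path_def o_def)
qed

lemma continuous_on_ellipse_velocity:
  assumes "\<rho> > 1"
  shows "continuous_on A (ellipse_velocity \<rho>)"
  unfolding ellipse_velocity_def Let_def circlepath
  using assms by (intro continuous_intros) auto

text \<open>AM-GM replaces the elliptic integral for the arc length by an elementary one.\<close>

lemma norm_ellipse_velocity_le:
  assumes "\<rho> > 1"
  defines "s \<equiv> sqrt (\<rho>\<^sup>2 + 1 / \<rho>\<^sup>2)"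
  shows "cmod (ellipse_velocity \<rho> t) \<le> pi * (s - cos (4 * pi * t) / s)"
proof -
  define x where "x = cmod (complex_of_real \<rho> * cis (2 * pi * t) - 1 / (complex_of_real \<rho> * cis (2 * pi * t)))"
  have "s > 0" using assms by (simp add: add_pos_nonneg)
  have "1 / (complex_of_real \<rho> * cis (2 * pi * t)) = cis (- (2 * pi * t)) / complex_of_real \<rho>"
    by (simp add: divide_inverse cis_inverse)
  then have "x\<^sup>2 = ((\<rho> - 1 / \<rho>) * cos (2 * pi * t))\<^sup>2 + ((\<rho> + 1 / \<rho>) * sin (2 * pi * t))\<^sup>2"
    unfolding x_def cmod_power2 by (simp add: algebra_simps)
  also have "\<dots> = (\<rho>\<^sup>2 + 1 / \<rho>\<^sup>2) * ((cos (2 * pi * t))\<^sup>2 + (sin (2 * pi * t))\<^sup>2)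
      - 2 * ((cos (2 * pi * t))\<^sup>2 - (sin (2 * pi * t))\<^sup>2)"
  proof -
    have "((\<rho> - 1 / \<rho>) * C)\<^sup>2 + ((\<rho> + 1 / \<rho>) * S)\<^sup>2
      = (\<rho>\<^sup>2 + 1 / \<rho>\<^sup>2) * (C\<^sup>2 + S\<^sup>2) - 2 * (C\<^sup>2 - S\<^sup>2)" for C S
      using assms by (simp add: field_simps power2_eq_square)
    then show ?thesis .
  qed
  also have "(cos (2 * pi * t))\<^sup>2 - (sin (2 * pi * t))\<^sup>2 = cos (4 * pi * t)"
    using cos_double[of "2 * pi * t"] by (simp add: mult.assoc)
  finally have x2: "x\<^sup>2 = s\<^sup>2 - 2 * cos (4 * pi * t)"
    by (simp add: s_def)
  \<comment> \<open>By \<open>x2\<close> the quadratic mean of \<open>x\<close> over the parameter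
    interval is \<open>s\<close>, so comparing \<open>x\<close> with \<open>s\<close> leaves only an
    oscillating term.\<close>
  have "2 * x * s \<le> x\<^sup>2 + s\<^sup>2"
    using sum_squares_bound by blast
  then have "x \<le> s - cos (4 * pi * t) / s"
    unfolding x2 using \<open>s > 0\<close> by (simp add: field_simps power2_eq_square)
  moreover have "cmod (ellipse_velocity \<rho> t) = pi * x"
    by (simp add: ellipse_velocity_def Let_def circlepath x_def norm_mult cis_conv_exp mult_ac)
  ultimately show ?thesis by simp
qed

text \<open>Integrating the pointwise bound on the velocity removes the cosine, whose argument
  \<open>4 * pi * t\<close> runs through two full periods.\<close>

lemma norm_contour_integral_ellipse_le:
  assumes "\<rho> > 1" and cont: "continuous_on (bernstein_ellipse \<rho>) f"
    and B: "\<And>z. z \<in> bernstein_ellipse \<rho> \<Longrightarrow> cmod (f z) \<le> B"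
  shows "cmod (contour_integral (ellipse_path \<rho>) f) \<le> B * (pi * sqrt (\<rho>\<^sup>2 + 1 / \<rho>\<^sup>2))"
proof -
  define s where "s = sqrt (\<rho>\<^sup>2 + 1 / \<rho>\<^sup>2)"
  have vd: "vector_derivative (ellipse_path \<rho>) (at t) = ellipse_velocity \<rho> t" for t
    by (rule vector_derivative_at[OF has_vector_derivative_ellipse_path[OF assms(1)]])
  have "f contour_integrable_on ellipse_path \<rho>"
    by (rule contour_integrable_continuous_C1[OF has_vector_derivative_ellipse_path[OF assms(1)]
        continuous_on_ellipse_velocity[OF assms(1)] valid_path_ellipse_path[OF assms(1)]])
      (simp add: path_image_ellipse_path assms)
  then have int: "(\<lambda>t. f (ellipse_path \<rho> t) * ellipse_velocity \<rho> t) integrable_on {0..1}"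
    by (simp add: contour_integrable_on vd)
  have "((\<lambda>t. cos (4 * pi * t)) has_integral
      (sin (4 * pi * 1) / (4 * pi) - sin (4 * pi * 0) / (4 * pi))) {0..1}"
    by (rule fundamental_theorem_of_calculus)
      (auto intro!: derivative_eq_intros simp flip: has_real_derivative_iff_has_vector_derivative)
  moreover have "sin (4 * pi) = 0" using sin_npi[of 4] by simp
  ultimately have "((\<lambda>t. cos (4 * pi * t)) has_integral 0) {0..1}" by simp
  then have "((\<lambda>t. B * (pi * (s - cos (4 * pi * t) / s))) has_integral
      (B * (pi * (s * (1 - 0) - 0 / s)))) {0..1}"
    by (intro has_integral_mult_right has_integral_diff has_integral_divide)
      (use has_integral_const_real[of s 0 1] in simp_all)
  then have bound: "((\<lambda>t. B * (pi * (s - cos (4 * pi * t) / s))) has_integral B * (pi * s)) {0..1}"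
    by simp
  have pt: "cmod (f (ellipse_path \<rho> t) * ellipse_velocity \<rho> t) \<le> B * (pi * (s - cos (4 * pi * t) / s))"
    if "t \<in> {0..1}" for t
  proof -
    have "ellipse_path \<rho> t \<in> bernstein_ellipse \<rho>"
      using that path_image_ellipse_path[OF assms(1)] by (auto simp: path_image_def)
    then have "cmod (f (ellipse_path \<rho> t)) \<le> B" by (rule B)
    then show ?thesis
      unfolding norm_mult s_def
      by (intro mult_mono norm_ellipse_velocity_le[OF assms(1)]) (auto intro: order_trans[OF norm_ge_zero])
  qed
  have "cmod (contour_integral (ellipse_path \<rho>) f)
      = cmod (integral {0..1} (\<lambda>t. f (ellipse_path \<rho> t) * ellipse_velocity \<rho> t))"
    by (simp add: contour_integral_integral vd)
  also have "\<dots> \<le> integral {0..1} (\<lambda>t. B * (pi * (s - cos (4 * pi * t) / s)))"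
    by (rule integral_norm_bound_integral[OF int has_integral_integrable[OF bound] pt])
  also have "\<dots> = B * (pi * s)"
    by (rule integral_unique[OF bound])
  finally show ?thesis by (simp add: s_def)
qed

text \<open>With \<open>z = (a + 1 / a) / 2\<close>, the integrand pulled back to the circle is the logarithmic derivative of
  \<open>(w - a) (w - 1 / a) / w\<close>.\<close>

lemma winding_number_ellipse_path:
  assumes "\<rho> > 1" "foci_sum z < \<rho> + 1 / \<rho>"
  shows "winding_number (ellipse_path \<rho>) z = 1"
proof -
  obtain a where a: "cmod a \<ge> 1" "joukowski a = z" by (rule joukowski_surj)
  then have "a \<noteq> 0" by auto
  have "cmod a < \<rho>"
    using norm_joukowski_foci[OF \<open>a \<noteq> 0\<close>] a add_inverse_less_iff[of "cmod a" \<rho>] assms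
    by (simp add: foci_sum_def)
  moreover have "cmod (1 / a) < \<rho>"
    using a assms by (auto simp: norm_divide divide_simps intro: le_less_trans)
  \<comment> \<open>All three poles lie inside the circle: \<open>a\<close> and \<open>1 / a\<close>
    contribute one each, the origin contributes minus one.\<close>
  ultimately have sum: "((\<lambda>w. 1 / (w - a) + 1 / (w - 1 / a) - 1 / (w - 0)) has_contour_integral
      (2 * of_real pi * \<i> * 1 + 2 * of_real pi * \<i> * 1 - 2 * of_real pi * \<i> * 1)) (circlepath 0 \<rho>)"
    using assms by (intro has_contour_integral_add has_contour_integral_diff
        Cauchy_integral_circlepath_simple[of "\<lambda>_. 1"] holomorphic_intros) auto
  have zE: "z \<notin> bernstein_ellipse \<rho>"
    using assms by (simp add: bernstein_ellipse_eq)
  have "contour_integral (ellipse_path \<rho>) (\<lambda>w. 1 / (w - z)) =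
      contour_integral (circlepath 0 \<rho>) (\<lambda>w. deriv joukowski w * (1 / (joukowski w - z)))"
    unfolding ellipse_path_def using assms
    by (intro contour_integral_comp_analyticW[of _ "- {0}"])
      (auto simp: analytic_on_open open_Compl holomorphic_joukowski)
  also have "\<dots> = contour_integral (circlepath 0 \<rho>) (\<lambda>w. 1 / (w - a) + 1 / (w - 1 / a) - 1 / (w - 0))"
  proof (rule contour_integral_cong)
    fix w assume "w \<in> path_image (circlepath 0 \<rho>)"
    then have w: "cmod w = \<rho>" using assms by simp
    then have "w \<noteq> 0" using assms by auto
    have "w \<noteq> a" "w \<noteq> 1 / a" using w \<open>cmod a < \<rho>\<close> \<open>cmod (1 / a) < \<rho>\<close> by auto
    have J: "joukowski w - z = (w - a) * (w - 1 / a) / (2 * w)"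
      using \<open>a \<noteq> 0\<close> \<open>w \<noteq> 0\<close> unfolding a(2)[symmetric] by (simp add: joukowski_def field_simps)
    have "1 / (w - a) + 1 / (w - b) - 1 / w = (w * (w - b) + w * (w - a) - (w - a) * (w - b)) / (w * (w - a) * (w - b))"
      if "w \<noteq> b" for b
      using \<open>w \<noteq> 0\<close> \<open>w \<noteq> a\<close> that by (simp add: divide_simps) (simp add: algebra_simps)
    from this[OF \<open>w \<noteq> 1 / a\<close>] have "1 / (w - a) + 1 / (w - 1 / a) - 1 / w
       = (w * (w - 1 / a) + w * (w - a) - (w - a) * (w - 1 / a)) / (w * (w - a) * (w - 1 / a))" .
    also have "w * (w - 1 / a) + w * (w - a) - (w - a) * (w - 1 / a) = w\<^sup>2 - 1"
      using \<open>a \<noteq> 0\<close> by (simp add: field_simps power2_eq_square)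
    finally have pf: "1 / (w - a) + 1 / (w - 1 / a) - 1 / w
       = (w\<^sup>2 - 1) / (w * (w - a) * (w - 1 / a))" .
    show "deriv joukowski w * (1 / (joukowski w - z)) = 1 / (w - a) + 1 / (w - 1 / a) - 1 / (w - 0)"
    proof -
      have "(1 - 1 / w\<^sup>2) / 2 * (1 / (D / (2 * w))) = (w\<^sup>2 - 1) / (w * D)" for D
        using \<open>w \<noteq> 0\<close> by (cases "D = 0") (simp_all add: field_simps power2_eq_square)
      from this[of "(w - a) * (w - 1 / a)"] \<open>w \<noteq> 0\<close>
      show ?thesis
        unfolding J DERIV_imp_deriv[OF has_field_derivative_joukowski[OF \<open>w \<noteq> 0\<close>]] mult.assoc diff_0_right
        using pf by (simp only: mult.assoc)
    qed
  qed simp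
  also have "\<dots> = 2 * of_real pi * \<i>"
    using contour_integral_unique[OF sum] by simp
  finally show ?thesis
    using zE assms by (subst winding_number_valid_path)
      (auto simp: valid_path_ellipse_path path_image_ellipse_path)
qed

subsection \<open>Lower bounds on the ellipse\<close>

lemma gcoeff_nz: "l > -1/2 \<Longrightarrow> l \<noteq> 0 \<Longrightarrow> gcoeff l n \<noteq> 0"
  by (force simp: gcoeff_def pochhammer_eq_0_iff)

lemma gcoeff_sums:
  assumes "cmod v < 1"
  shows "(\<lambda>k. of_real (gcoeff l k) * v ^ k) sums ((1 - v) powr (- of_real l))"
proof -
  have "(of_real (- l) gchoose k) * (- v) ^ k = of_real (gcoeff l k) * v ^ k" for k
  proof -
    have "(of_real (- l) gchoose k) * (- v) ^ k =
        ((- 1) ^ k * (- 1) ^ k) * (pochhammer (of_real l) k / fact k * v ^ k)"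
      unfolding gbinomial_pochhammer power_minus[of v k] by (simp only: of_real_minus minus_minus) simp
    also have "(- 1) ^ k * (- 1) ^ k = (1 :: complex)"
      by (simp flip: power_mult_distrib)
    finally show ?thesis
      by (simp add: gcoeff_def pochhammer_of_real)
  qed
  then show ?thesis
    using gen_binomial_complex[of "- v" "of_real (- l)"] assms by simp
qed

lemma gcoeff_ratio_tendsto: 
  assumes "l > -1/2" "l \<noteq> 0"
  shows "(\<lambda>n. gcoeff l n / gcoeff l (Suc n)) \<longlonglongrightarrow> 1"
proof -
  have "gcoeff l n / gcoeff l (Suc n) = (real n + 1) / (real n + l)" for n
  proof -
    have "real n + l \<noteq> 0" using assms by (cases n) auto
    then show ?thesis
      using gcoeff_Suc[of n l] gcoeff_nz[OF assms, of "Suc n"] by (simp add: field_simps)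
  qed
  moreover have "(\<lambda>n. (real n + 1) / (real n + l)) \<longlonglongrightarrow> 1"
    by real_asymp
  ultimately show ?thesis by simp
qed

lemma gcoeff_shift_ratio_tendsto:
  assumes "l > -1/2" "l \<noteq> 0"
  shows "(\<lambda>n. gcoeff l n / gcoeff l (n + k)) \<longlonglongrightarrow> 1"
proof (induction k)
  case 0
  then show ?case using gcoeff_nz[OF assms] by simp
next
  case (Suc k)
  have "(\<lambda>n. gcoeff l n / gcoeff l (n + k) * (gcoeff l (n + k) / gcoeff l (Suc (n + k)))) \<longlonglongrightarrow> 1 * 1"
    using gcoeff_ratio_tendsto[OF assms] by (intro tendsto_mult Suc) (rule LIMSEQ_ignore_initial_segment)
  then show ?case using gcoeff_nz[OF assms] by simp
qed

text \<open>Before the index \<open>J\<close> where monotonicity sets in, there are finitely many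
  positive values, and the quotient of their maximum by their minimum is an admissible
  \<open>K\<close>. This turns an asymptotic statement into a bound for all indices.\<close>

lemma eventually_incseq_imp_quasi_incseq:
  fixes h :: "nat \<Rightarrow> real"
  assumes pos: "\<And>n. h n > 0" and "\<forall>\<^sub>F n in sequentially. h n \<le> h (Suc n)"
  obtains K where "K > 0" "\<And>m n. m \<le> n \<Longrightarrow> h m \<le> K * h n"
proof -
  obtain J where J: "\<And>n. n \<ge> J \<Longrightarrow> h n \<le> h (Suc n)"
    using assms(2) by (auto simp: eventually_sequentially)
  have inc: "h m \<le> h n" if "J \<le> m" "m \<le> n" for m n
    using that(2) by (induction rule: dec_induct) (use J that(1) in \<open>auto intro: order_trans\<close>)
  define c where "c = Min (h ` {..J})"
  define D where "D = Max (h ` {..J})"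
  have c: "c > 0" using pos by (simp add: c_def)
  have cD: "c \<le> h i" "h i \<le> D" if "i \<le> J" for i
    using that by (auto simp: c_def D_def)
  have "c \<le> D" using cD[of J] by simp
  have "h m \<le> D / c * h n" if "m \<le> n" for m n
  proof (cases "J \<le> m")
    case True
    have "1 * h n \<le> D / c * h n"
      using \<open>c \<le> D\<close> c pos[of n] by (intro mult_right_mono) (auto simp: less_imp_le)
    with inc[OF True that] show ?thesis by simp
  next
    case False
    have "c \<le> h n"
      using cD(1)[of n] cD(1)[of J] inc[of J n] by (cases "n \<le> J") auto
    then have "D / c * c \<le> D / c * h n"
      using c \<open>c \<le> D\<close> by (intro mult_left_mono) auto
    with cD(2)[of m] False c show ?thesis by simp
  qed
  moreover have "D / c > 0" using c \<open>c \<le> D\<close> by simp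
  ultimately show ?thesis using that by blast
qed

text \<open>Successive quotients tend to \<open>1 < \<rho>\<close>, so
  \<open>\<bar>gcoeff l n\<bar> * \<rho> ^ n\<close> eventually increases. The growth
  \<open>\<rho> ^ k\<close> allowed here is outweighed by the factor
  \<open>(1 / \<rho>^2) ^ k\<close> of the series on the ellipse.\<close>

lemma gcoeff_ratio_bound:
  assumes "l > -1/2" "l \<noteq> 0" "\<rho> > 1"
  obtains K where "K > 0" "\<And>k n. k \<le> n \<Longrightarrow> \<bar>gcoeff l (n - k) / gcoeff l n\<bar> \<le> K * \<rho> ^ k"
proof -
  have "\<forall>\<^sub>F n in sequentially. gcoeff l n / gcoeff l (Suc n) < \<rho>"
    "\<forall>\<^sub>F n in sequentially. gcoeff l n / gcoeff l (Suc n) > - \<rho>"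
    using gcoeff_ratio_tendsto[OF assms(1,2)] assms(3) by (auto intro: order_tendstoD)
  then have "\<forall>\<^sub>F n in sequentially. \<bar>gcoeff l n\<bar> * \<rho> ^ n \<le> \<bar>gcoeff l (Suc n)\<bar> * \<rho> ^ Suc n"
  proof eventually_elim
    case (elim n)
    then have "\<bar>gcoeff l n / gcoeff l (Suc n)\<bar> \<le> \<rho>" by linarith
    then have "\<bar>gcoeff l n\<bar> \<le> \<rho> * \<bar>gcoeff l (Suc n)\<bar>"
      using gcoeff_nz[OF assms(1,2), of "Suc n"] by (simp add: abs_divide divide_le_eq)
    then have "\<bar>gcoeff l n\<bar> * \<rho> ^ n \<le> \<rho> * \<bar>gcoeff l (Suc n)\<bar> * \<rho> ^ n"
      using assms by (intro mult_right_mono) auto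
    then show ?case by (simp add: mult_ac)
  qed
  then obtain K where K: "K > 0" "\<And>m n. m \<le> n \<Longrightarrow> \<bar>gcoeff l m\<bar> * \<rho> ^ m \<le> K * (\<bar>gcoeff l n\<bar> * \<rho> ^ n)"
    using eventually_incseq_imp_quasi_incseq[of "\<lambda>n. \<bar>gcoeff l n\<bar> * \<rho> ^ n"] gcoeff_nz[OF assms(1,2)] assms(3)
    by auto
  have "\<bar>gcoeff l (n - k) / gcoeff l n\<bar> \<le> K * \<rho> ^ k" if "k \<le> n" for k n
  proof -
    have "\<rho> ^ n = \<rho> ^ (n - k) * \<rho> ^ k" using that by (simp flip: power_add)
    then have "\<bar>gcoeff l (n - k)\<bar> * \<rho> ^ (n - k) \<le> (K * \<rho> ^ k * \<bar>gcoeff l n\<bar>) * \<rho> ^ (n - k)"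
      using K(2)[of "n - k" n] by (simp add: mult_ac)
    then have "\<bar>gcoeff l (n - k)\<bar> \<le> K * \<rho> ^ k * \<bar>gcoeff l n\<bar>"
      using assms by (subst (asm) mult_le_cancel_right) auto
    then show ?thesis
      using gcoeff_nz[OF assms(1,2), of n] by (simp add: abs_divide divide_le_eq)
  qed
  with K(1) that show ?thesis by blast
qed

text \<open>For \<open>l \<noteq> 0\<close> this is the minimum of the modulus of
  \<open>(1 - w^-2)\<close> to the power \<open>- l\<close> over \<open>cmod w = \<rho>\<close>,
  attained at \<open>w = i \<rho>\<close> if \<open>l > 0\<close> and at \<open>w = \<rho>\<close>
  if \<open>l < 0\<close>. Its reciprocal is the case distinction in
  \<open>Lambda_bound\<close>.\<close>

definition ellipse_modulus :: "real \<Rightarrow> real \<Rightarrow> real" where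
  "ellipse_modulus \<rho> l = (if l > 0 then (1 + 1 / \<rho>\<^sup>2) powr (- l) else (1 - 1 / \<rho>\<^sup>2) powr (- l))"

lemma ellipse_modulus_pos:
  assumes "\<rho> > 1"
  shows "ellipse_modulus \<rho> l > 0"
proof -
  have "\<rho>\<^sup>2 > 1" using assms by (simp add: one_less_power)
  moreover have "1 + 1 / \<rho>\<^sup>2 > 0" by (simp add: add_pos_nonneg)
  ultimately show ?thesis by (auto simp: ellipse_modulus_def)
qed

lemma ellipse_modulus_le:
  assumes "\<rho> > 1" "cmod w = \<rho>"
  shows "ellipse_modulus \<rho> l \<le> cmod ((1 - inverse w ^ 2) powr (- of_real l))"
proof -
  have v: "cmod (inverse w ^ 2) = 1 / \<rho>\<^sup>2"
    unfolding norm_power norm_inverse assms(2) by (simp add: field_simps)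
  have r: "1 / \<rho>\<^sup>2 < 1" using assms by (simp add: one_less_power)
  have up: "cmod (1 - inverse w ^ 2) \<le> 1 + 1 / \<rho>\<^sup>2"
    using norm_triangle_ineq4[of 1 "inverse w ^ 2"] v by simp
  have lo: "1 - 1 / \<rho>\<^sup>2 \<le> cmod (1 - inverse w ^ 2)"
    using norm_triangle_ineq2[of 1 "inverse w ^ 2"] v by simp
  have "cmod ((1 - inverse w ^ 2) powr (- of_real l)) = cmod (1 - inverse w ^ 2) powr (- l)"
    by (subst norm_powr_real_powr') auto
  moreover have "(1 + 1 / \<rho>\<^sup>2) powr (- l) \<le> cmod (1 - inverse w ^ 2) powr (- l)" if "l > 0"
    using up lo r that by (intro powr_mono2') auto
  moreover have "(1 - 1 / \<rho>\<^sup>2) powr (- l) \<le> cmod (1 - inverse w ^ 2) powr (- l)" if "\<not> l > 0"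
    using lo r that by (intro powr_mono2) auto
  ultimately show ?thesis by (simp add: ellipse_modulus_def)
qed

text \<open>After division by \<open>gcoeff l n * w ^ n\<close> the polynomial is compared term by
  term with the binomial series of \<open>(1 - w^-2)\<close> to the power \<open>- l\<close>. The
  differences are bounded through \<open>cmod w = \<rho>\<close> alone, which makes
  \<open>\<epsilon>\<close> independent of the point on the ellipse.\<close>

lemma cgegenbauer_ellipse_lower_bound:
  assumes l: "l > -1/2" "l \<noteq> 0" and \<rho>: "\<rho> > 1"
  obtains \<epsilon> :: "nat \<Rightarrow> real" where "\<epsilon> \<longlonglongrightarrow> 0"
    "\<And>n z. z \<in> bernstein_ellipse \<rho> \<Longrightarrow>
      \<bar>gcoeff l n\<bar> * \<rho> ^ n * (ellipse_modulus \<rho> l - \<epsilon> n) \<le> cmod (poly (cgegenbauer l n) z)"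
proof -
  \<comment> \<open>The value 0 for \<open>k > n\<close> extends the finite sum to a series; for
    fixed \<open>k\<close> the quotient tends to 1.\<close>
  define r where "r n k = (if k \<le> n then gcoeff l (n - k) / gcoeff l n else 0)" for n k
  define a where "a k n = \<bar>gcoeff l k\<bar> * \<bar>r n k - 1\<bar> * (1 / \<rho>\<^sup>2) ^ k" for k n
  obtain K where K: "K > 0" "\<And>k n. k \<le> n \<Longrightarrow> \<bar>gcoeff l (n - k) / gcoeff l n\<bar> \<le> K * \<rho> ^ k"
    using gcoeff_ratio_bound[OF l \<rho>] by blast
  \<comment> \<open>The bound \<open>K * \<rho> ^ k\<close> on the quotient uses up one of the two
    powers of \<open>1 / \<rho>\<close>; the added 1 accounts for the subtracted 1 in
    \<open>a\<close>.\<close>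
  define M where "M k = (K + 1) * (\<bar>gcoeff l k\<bar> * (1 / \<rho>) ^ k)" for k
  have bound: "norm (a k n) \<le> M k" for k n
  proof -
    have "1 \<le> \<rho> ^ k" using \<rho> by simp
    moreover have "\<bar>r n k\<bar> \<le> K * \<rho> ^ k" using K \<rho> by (auto simp: r_def)
    ultimately have "\<bar>r n k - 1\<bar> \<le> (K + 1) * \<rho> ^ k" by (simp add: algebra_simps abs_le_iff)
    then have "a k n \<le> \<bar>gcoeff l k\<bar> * ((K + 1) * \<rho> ^ k) * (1 / \<rho>\<^sup>2) ^ k"
      unfolding a_def by (intro mult_right_mono mult_left_mono) auto
    also have "\<dots> = M k"
      using \<rho> by (simp add: M_def field_simps power2_eq_square)
    finally show ?thesis by (simp add: a_def)
  qed
  have "summable M"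
  proof -
    \<comment> \<open>\<open>powser_insidea\<close> gives absolute convergence at points of smaller
      modulus than a point of convergence, so \<open>x\<close> is placed between
      \<open>1 / \<rho>\<close> and 1.\<close>
    obtain x where x: "1 / \<rho> < x" "x < 1" using \<rho> dense[of "1 / \<rho>" 1] by auto
    then have "x > 0" using \<rho> by (intro less_trans[of 0 "1 / \<rho>" x]) auto
    have "summable (\<lambda>k. complex_of_real (gcoeff l k) * of_real x ^ k)"
      using gcoeff_sums[of "of_real x" l] x \<open>x > 0\<close> by (auto dest: sums_summable)
    then have "summable (\<lambda>k. norm (complex_of_real (gcoeff l k) * of_real (1 / \<rho>) ^ k))"
      using x \<open>x > 0\<close> \<rho> by (intro powser_insidea) (auto simp: norm_divide)
    then show ?thesis
      unfolding M_def using \<rho> by (intro summable_mult) (simp add: norm_mult norm_power norm_divide)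
  qed
  have lim: "(\<lambda>n. a k n) \<longlonglongrightarrow> 0" for k
  proof -
    have "(\<lambda>n. r (n + k) k) \<longlonglongrightarrow> 1"
      using gcoeff_shift_ratio_tendsto[OF l] by (simp add: r_def)
    then have "(\<lambda>n. r n k) \<longlonglongrightarrow> 1" by (rule LIMSEQ_offset)
    then have "(\<lambda>n. a k n) \<longlonglongrightarrow> \<bar>gcoeff l k\<bar> * \<bar>1 - 1\<bar> * (1 / \<rho>\<^sup>2) ^ k"
      unfolding a_def by (intro tendsto_intros)
    then show ?thesis by simp
  qed
  have summable_a: "summable (\<lambda>k. a k n)" for n
    by (rule summable_comparison_test'[OF \<open>summable M\<close> bound])
  show ?thesis
  proof (rule that)
    show "(\<lambda>n. \<Sum>k. a k n) \<longlonglongrightarrow> 0"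
      using tannerys_theorem[OF lim _ \<open>summable M\<close>] bound by (simp add: always_eventually)
  next
    fix n z assume "z \<in> bernstein_ellipse \<rho>"
    then obtain w where w: "cmod w = \<rho>" "z = joukowski w"
      by (auto simp: bernstein_ellipse_eq_image[OF \<rho>])
    then have "w \<noteq> 0" using \<rho> by auto
    define v where "v = inverse w ^ 2"
    have v: "cmod v = 1 / \<rho>\<^sup>2"
      unfolding v_def norm_power norm_inverse w(1) by (simp add: field_simps)
    have "1 / \<rho>\<^sup>2 < 1" using \<rho> by (simp add: one_less_power)
    define F where "F = (\<Sum>k\<le>n. of_real (gcoeff l k) * of_real (r n k) * v ^ k)"
    have "poly (cgegenbauer l n) z = of_real (gcoeff l n) * w ^ n * F"
      unfolding w(2) cgegenbauer_joukowski[OF \<open>w \<noteq> 0\<close>] F_def sum_distrib_left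
    proof (rule sum.cong)
      fix k assume "k \<in> {..n}"
      then have "w ^ n = w ^ (n - k) * w ^ k" by (simp flip: power_add)
      then show "of_real (gcoeff l k) * of_real (gcoeff l (n - k)) * w ^ (n - k) * inverse w ^ k =
          of_real (gcoeff l n) * w ^ n * (of_real (gcoeff l k) * of_real (r n k) * v ^ k)"
        using \<open>k \<in> {..n}\<close> gcoeff_nz[OF l, of n] \<open>w \<noteq> 0\<close>
        by (simp add: r_def v_def field_simps power2_eq_square)
    qed simp
    then have norm_eq: "cmod (poly (cgegenbauer l n) z) = \<bar>gcoeff l n\<bar> * \<rho> ^ n * cmod F"
      using w by (simp add: norm_mult norm_power)
    have "(\<lambda>k. of_real (gcoeff l k) * of_real (r n k) * v ^ k) sums F"
      unfolding F_def by (rule sums_finite) (auto simp: r_def)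
    from sums_diff[OF this gcoeff_sums[of v l]]
    have diff: "(\<lambda>k. of_real (gcoeff l k) * of_real (r n k - 1) * v ^ k) sums (F - (1 - v) powr (- of_real l))"
      using v \<open>1 / \<rho>\<^sup>2 < 1\<close> by (simp add: algebra_simps)
    have a_eq: "cmod (of_real (gcoeff l k) * of_real (r n k - 1) * v ^ k) = a k n" for k
      unfolding norm_mult norm_power v norm_of_real a_def ..
    have "cmod (F - (1 - v) powr (- of_real l)) \<le> (\<Sum>k. a k n)"
      using summable_norm[of "\<lambda>k. of_real (gcoeff l k) * of_real (r n k - 1) * v ^ k"] summable_a[of n]
      unfolding sums_unique[OF diff, symmetric] a_eq by blast
    moreover have "ellipse_modulus \<rho> l \<le> cmod ((1 - v) powr (- of_real l))"
      unfolding v_def by (rule ellipse_modulus_le[OF \<rho> w(1)])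
    ultimately have "ellipse_modulus \<rho> l - (\<Sum>k. a k n) \<le> cmod F"
      using norm_triangle_ineq2[of "(1 - v) powr (- of_real l)" F] by (simp add: norm_minus_commute)
    then show "\<bar>gcoeff l n\<bar> * \<rho> ^ n * (ellipse_modulus \<rho> l - (\<Sum>k. a k n)) \<le> cmod (poly (cgegenbauer l n) z)"
      unfolding norm_eq using \<rho> by (intro mult_left_mono) auto
  qed
qed

text \<open>All zeros lie on the segment between the foci, where \<open>foci_sum\<close> is 2, less
  than \<open>\<rho> + 1 / \<rho>\<close>.\<close>

lemma cgegenbauer_ellipse_nz:
  assumes l: "l > -1/2" "l \<noteq> 0" and \<rho>: "\<rho> > 1" and z: "foci_sum z \<ge> \<rho> + 1 / \<rho>"
  shows "poly (cgegenbauer l (Suc n)) z \<noteq> 0"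
proof
  assume "poly (cgegenbauer l (Suc n)) z = 0"
  then obtain x where x: "z = of_real x" "\<bar>x\<bar> < 1"
    by (rule cgegenbauer_root_obtains[OF l])
  have "z - 1 = of_real (x - 1)" "z + 1 = of_real (x + 1)" using x by simp_all
  then have "foci_sum z = 2"
    unfolding foci_sum_def using x(2) by (simp only: norm_of_real)
  with z add_inverse_less_iff[of 1 \<rho>] \<rho> show False by simp
qed

lemma compact_bernstein_ellipse:
  assumes "\<rho> > 1"
  shows "compact (bernstein_ellipse \<rho>)"
  unfolding bernstein_ellipse_eq_image[OF assms] using assms
  by (intro compact_continuous_image holomorphic_on_imp_continuous_on
      holomorphic_on_subset[OF holomorphic_joukowski]) auto

text \<open>The asymptotic lower bound may fail to be positive for small indices; compactness
  supplies a positive one for each index.\<close>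

lemma cgegenbauer_ellipse_bounded_below:
  assumes l: "l > -1/2" "l \<noteq> 0" and \<rho>: "\<rho> > 1"
  obtains \<kappa> where "\<kappa> > 0" "\<And>z. z \<in> bernstein_ellipse \<rho> \<Longrightarrow> \<kappa> \<le> cmod (poly (cgegenbauer l (Suc n)) z)"
proof -
  have "bernstein_ellipse \<rho> \<noteq> {}"
    using \<rho> by (simp add: bernstein_ellipse_eq_image)
  moreover have "continuous_on (bernstein_ellipse \<rho>) (\<lambda>z. cmod (poly (cgegenbauer l (Suc n)) z))"
    by (intro continuous_intros)
  ultimately obtain z0 where z0: "z0 \<in> bernstein_ellipse \<rho>"
    "\<forall>z \<in> bernstein_ellipse \<rho>. cmod (poly (cgegenbauer l (Suc n)) z0) \<le> cmod (poly (cgegenbauer l (Suc n)) z)"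
    using continuous_attains_inf[OF compact_bernstein_ellipse[OF \<rho>]] by blast
  have "cmod (poly (cgegenbauer l (Suc n)) z0) > 0"
    using z0(1) cgegenbauer_ellipse_nz[OF l \<rho>, of z0 n] by (simp add: bernstein_ellipse_eq[OF \<rho>])
  with z0 that show ?thesis by blast
qed

section \<open>Growth of the coefficients in terms of Gamma\<close>

text \<open>Both coefficients are Pochhammer quotients, which Gauss' product compares with powers of
  \<open>n\<close>; the exponents \<open>2 l + 2\<close> and \<open>l\<close> leave
  \<open>l + 2\<close>. The remaining constant is 1 because
  \<open>Gamma (l + 1) = l * Gamma l\<close>.\<close>

lemma gcoeff_Gamma_ratio_tendsto:
  assumes "l > -1/2" "l \<noteq> 0"
  shows "(\<lambda>n. \<bar>l\<bar> * gcoeff (2 * l + 2) n * Gamma (2 * l + 2) /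
    (\<bar>gcoeff l (Suc n)\<bar> * Gamma (l + 1) * real n powr (l + 2))) \<longlonglongrightarrow> 1"
proof -
  have npos: "l \<notin> \<int>\<^sub>\<le>\<^sub>0"
    using assms by (auto elim!: nonpos_Ints_cases)
  have pos: "Gamma (2 * l + 2) > 0" "Gamma (l + 1) > 0"
    using assms by (auto intro: Gamma_real_pos)
  \<comment> \<open>The last quotient corrects the indices: \<open>Gamma_series\<close> contains
    \<open>pochhammer\<close> of length \<open>n + 1\<close> and \<open>fact n\<close>, whereas the
    claim has length \<open>n\<close> at \<open>2 l + 2\<close> and \<open>fact (Suc n)\<close> at
    \<open>l\<close>.\<close>
  define R where "R n = \<bar>l\<bar> * \<bar>Gamma_series l n\<bar> * Gamma (2 * l + 2) / (Gamma_series (2 * l + 2) n * Gamma (l + 1))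
      * ((real n + 1) / (real n + 2 * l + 2))" for n
  have "R \<longlonglongrightarrow> \<bar>l\<bar> * \<bar>Gamma l\<bar> * Gamma (2 * l + 2) / (Gamma (2 * l + 2) * Gamma (l + 1)) * 1"
    unfolding R_def using pos
    by (intro tendsto_intros Gamma_series_LIMSEQ) (simp, real_asymp)
  also have "\<bar>l\<bar> * \<bar>Gamma l\<bar> * Gamma (2 * l + 2) / (Gamma (2 * l + 2) * Gamma (l + 1)) * 1 = 1"
  proof -
    have "\<bar>l\<bar> * \<bar>Gamma l\<bar> = \<bar>Gamma (l + 1)\<bar>"
      unfolding Gamma_plus1[OF npos] abs_mult ..
    then show ?thesis using pos by simp
  qed
  finally have "R \<longlonglongrightarrow> 1" .
  moreover have "\<forall>\<^sub>F n in sequentially. R n = \<bar>l\<bar> * gcoeff (2 * l + 2) n * Gamma (2 * l + 2) /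
    (\<bar>gcoeff l (Suc n)\<bar> * Gamma (l + 1) * real n powr (l + 2))"
    using eventually_gt_at_top[of 0]
  proof eventually_elim
    case (elim n)
    have p: "pochhammer (2 * l + 2) n > 0" using assms by (intro pochhammer_pos) auto
    have q: "pochhammer l (Suc n) \<noteq> 0" using gcoeff_nz[OF assms, of "Suc n"] by (auto simp: gcoeff_def)
    have s: "real n + 2 * l + 2 > 0" using assms by simp
    have e: "exp ((2 * l + 2) * ln (real n)) = exp (l * ln (real n)) * exp ((l + 2) * ln (real n))"
      by (simp add: algebra_simps flip: exp_add)
    have "R n = \<bar>l\<bar> * (fact n * exp (l * ln (real n)) / \<bar>pochhammer l (Suc n)\<bar>) * Gamma (2 * l + 2) /
        (fact n * exp ((2 * l + 2) * ln (real n)) / (pochhammer (2 * l + 2) n * (real n + 2 * l + 2)) * Gamma (l + 1))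
        * ((real n + 1) / (real n + 2 * l + 2))"
    proof -
      have "pochhammer (2 * l + 2) (n + 1) = pochhammer (2 * l + 2) n * (real n + 2 * l + 2)"
        by (simp add: pochhammer_Suc algebra_simps)
      then show ?thesis
        unfolding R_def Gamma_series_def by (simp add: abs_divide abs_mult)
    qed
    also have "\<dots> = \<bar>l\<bar> * (pochhammer (2 * l + 2) n / fact n) * Gamma (2 * l + 2) /
        (\<bar>pochhammer l (Suc n)\<bar> / fact (Suc n) * Gamma (l + 1) * exp ((l + 2) * ln (real n)))"
      unfolding e using p q s pos by (simp add: divide_simps)
    also have "exp ((l + 2) * ln (real n)) = real n powr (l + 2)"
      using elim by (simp add: powr_def)
    finally show ?case by (simp add: gcoeff_def abs_divide)
  qed
  ultimately show ?thesis by (rule Lim_transform_eventually)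
qed

subsection \<open>The error estimate\<close>

text \<open>The lower bound \<open>\<kappa>\<close> is left open, so that the estimate serves both
  the asymptotic bound and the one from compactness.\<close>

lemma gauss_interpolation_derivative_bound:
  assumes l: "l > -1/2" "l \<noteq> 0" and \<rho>: "\<rho> > 1"
    and \<kappa>: "\<kappa> > 0" "\<And>z. z \<in> bernstein_ellipse \<rho> \<Longrightarrow> \<kappa> \<le> cmod (poly (cgegenbauer l (Suc n)) z)"
    and u: "u analytic_on (bernstein_ellipse \<rho> \<union> inside (bernstein_ellipse \<rho>))"
    and p: "is_gauss_interpolant l n u p"
    and x: "x \<in> gegenbauer_gauss_points l n"
  shows "cmod (deriv (\<lambda>z. u z - poly p z) (of_real x)) \<le>
    2 * \<bar>l\<bar> * gcoeff (2 * l + 2) n * ellipse_max \<rho> u * sqrt (\<rho>\<^sup>2 + 1 / \<rho>\<^sup>2) * \<rho> / ((\<rho> - 1)\<^sup>2 * \<kappa>)"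
    (is "_ \<le> ?rhs")
proof -
  let ?P = "cgegenbauer l (Suc n)" and ?E = "bernstein_ellipse \<rho>"
  let ?M = "ellipse_max \<rho> u" and ?s = "sqrt (\<rho>\<^sup>2 + 1 / \<rho>\<^sup>2)"
  define S where "S = {z. foci_sum z \<le> \<rho> + 1 / \<rho>}"
  define T where "T = {z. foci_sum z < \<rho> + 1 / \<rho>}"
  define A where "A = complex_of_real ` gegenbauer_gauss_points l n"
  define G where "G = contour_integral (ellipse_path \<rho>) (\<lambda>z. u z / (poly ?P z * (z - of_real x)))"
  \<comment> \<open>The distance from the focus 1 to the vertex
    \<open>(\<rho> + 1 / \<rho>) / 2\<close> of the ellipse.\<close>
  define \<delta> where "\<delta> = (\<rho> - 1)\<^sup>2 / (2 * \<rho>)"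
  have "\<delta> > 0" using \<rho> by (simp add: \<delta>_def)
  have SE: "S \<subseteq> ?E \<union> inside ?E"
  proof
    fix z assume "z \<in> S"
    then consider "foci_sum z < \<rho> + 1 / \<rho>" | "foci_sum z = \<rho> + 1 / \<rho>"
      by (force simp: S_def)
    then show "z \<in> ?E \<union> inside ?E"
      using foci_sum_sublevel_subset_inside[OF \<rho>] bernstein_ellipse_eq[OF \<rho>] by cases blast+
  qed
  have "open T"
    unfolding T_def by (intro open_Collect_less continuous_intros)
  have "T \<subseteq> interior S"
    by (rule interior_maximal[OF _ \<open>open T\<close>]) (auto simp: S_def T_def)
  have node: "\<bar>y\<bar> < 1" "poly ?P (of_real y) = 0" if "y \<in> gegenbauer_gauss_points l n" for y
    using that gegenbauer_real_root_abs_less_1[OF l, of n y]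
    by (auto simp: gegenbauer_gauss_points_def poly_cgegenbauer_of_real)
  have "A \<subseteq> T"
    using node(2) cgegenbauer_ellipse_nz[OF l \<rho>] by (force simp: A_def T_def not_less)
  have uS: "u holomorphic_on S"
    using u SE by (meson analytic_imp_holomorphic analytic_on_subset)
  have cont_u: "continuous_on ?E u"
    using u by (meson analytic_imp_holomorphic analytic_on_subset holomorphic_on_imp_continuous_on sup_ge1)
  have bdd: "bdd_above ((\<lambda>z. cmod (u z)) ` ?E)"
    by (intro bounded_imp_bdd_above compact_imp_bounded compact_continuous_image continuous_intros cont_u
        compact_bernstein_ellipse[OF \<rho>])
  have uM: "cmod (u z) \<le> ?M" if "z \<in> ?E" for z
    unfolding ellipse_max_def by (rule cSUP_upper[OF that bdd])
  have "?E \<noteq> {}" using \<rho> by (simp add: bernstein_ellipse_eq_image)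
  then have "?M \<ge> 0" using uM by (meson all_not_in_conv norm_ge_zero order_trans)
  have deriv_eq: "deriv (\<lambda>z. u z - poly p z) (of_real x) = poly (pderiv ?P) (of_real x) / (2 * pi * \<i>) * G"
    unfolding G_def
  proof (rule deriv_interpolation_error[where \<gamma>' = "ellipse_velocity \<rho>" and S = S and T = T and A = A])
    show "convex S" unfolding S_def by (rule convex_foci_sum_sublevel)
    show "u holomorphic_on S" by (rule uS)
    show "path_image (ellipse_path \<rho>) \<subseteq> S" "T \<inter> path_image (ellipse_path \<rho>) = {}"
      by (auto simp: S_def T_def path_image_ellipse_path[OF \<rho>] bernstein_ellipse_eq[OF \<rho>])
    show "winding_number (ellipse_path \<rho>) z = 1" if "z \<in> T" for z
      using that winding_number_ellipse_path[OF \<rho>] by (simp add: T_def)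
    show "poly ?P z \<noteq> 0" if "z \<in> path_image (ellipse_path \<rho>)" for z
      using that cgegenbauer_ellipse_nz[OF l \<rho>]
      by (simp add: path_image_ellipse_path[OF \<rho>] bernstein_ellipse_eq[OF \<rho>])
    show "card A = degree ?P"
      by (simp add: A_def card_image inj_on_def card_gauss_points[OF l] degree_cgegenbauer[OF l])
    show "degree p < degree ?P"
      using p by (simp add: degree_cgegenbauer[OF l] is_gauss_interpolant_def)
    show "poly p z = u z" "poly ?P z = 0" if "z \<in> A" for z
      using that p node by (auto simp: A_def is_gauss_interpolant_def)
    show "of_real x \<in> A" using x by (simp add: A_def)
    show "(ellipse_path \<rho> has_vector_derivative ellipse_velocity \<rho> t) (at t)" for t
      by (rule has_vector_derivative_ellipse_path[OF \<rho>])
    show "continuous_on {0..1} (ellipse_velocity \<rho>)"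
      by (rule continuous_on_ellipse_velocity[OF \<rho>])
    show "valid_path (ellipse_path \<rho>)" "pathfinish (ellipse_path \<rho>) = pathstart (ellipse_path \<rho>)"
      by (rule valid_path_ellipse_path[OF \<rho>], rule closed_ellipse_path)
  qed (rule \<open>open T\<close> \<open>T \<subseteq> interior S\<close> \<open>A \<subseteq> T\<close>)+
  have dist: "\<delta> \<le> cmod (z - of_real x)" if "z \<in> ?E" for z
  proof -
    \<comment> \<open>The distances from the node to the foci add up to 2, so adding the two
      triangle inequalities bounds \<open>foci_sum z\<close> by
      \<open>2 * cmod (z - of_real x) + 2\<close>.\<close>
    have "cmod (z - 1) \<le> cmod (z - of_real x) + (1 - x)"
      using norm_triangle_ineq[of "z - of_real x" "of_real (x - 1)"] node(1)[OF x]
      unfolding norm_of_real by simp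
    moreover have "cmod (z + 1) \<le> cmod (z - of_real x) + (1 + x)"
      using norm_triangle_ineq[of "z - of_real x" "of_real (x + 1)"] node(1)[OF x]
      unfolding norm_of_real by simp
    ultimately have "\<rho> + 1 / \<rho> \<le> 2 * cmod (z - of_real x) + 2"
      using that by (simp add: bernstein_ellipse_eq[OF \<rho>] foci_sum_def)
    moreover have "2 * \<delta> = \<rho> + 1 / \<rho> - 2"
      using \<rho> by (simp add: \<delta>_def field_simps power2_eq_square)
    ultimately show ?thesis by simp
  qed
  have "cmod G \<le> ?M / (\<kappa> * \<delta>) * (pi * ?s)"
    unfolding G_def
  proof (rule norm_contour_integral_ellipse_le[OF \<rho>])
    have nz: "poly ?P z \<noteq> 0" "z - of_real x \<noteq> 0" if "z \<in> ?E" for z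
      using \<kappa>(1) \<kappa>(2)[OF that] dist[OF that] \<open>\<delta> > 0\<close> by auto
    then show "continuous_on ?E (\<lambda>z. u z / (poly ?P z * (z - of_real x)))"
      by (intro continuous_intros cont_u) auto
    show "cmod (u z / (poly ?P z * (z - of_real x))) \<le> ?M / (\<kappa> * \<delta>)" if "z \<in> ?E" for z
      unfolding norm_divide norm_mult using \<kappa> \<open>\<delta> > 0\<close> dist[OF that] uM[OF that] that
      by (intro frac_le mult_mono mult_pos_pos) (auto intro: order_trans[OF norm_ge_zero])
  qed
  moreover have "cmod (poly (pderiv ?P) (of_real x)) \<le> 2 * \<bar>l\<bar> * gcoeff (2 * l + 2) n"
  proof -
    have "\<bar>poly (gegenbauer (l + 1) n) x\<bar> \<le> gcoeff (2 * (l + 1)) n"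
      using l node(1)[OF x] by (intro abs_poly_gegenbauer_le) auto
    then have "2 * \<bar>l\<bar> * \<bar>poly (gegenbauer (l + 1) n) x\<bar> \<le> 2 * \<bar>l\<bar> * gcoeff (2 * l + 2) n"
      by (intro mult_left_mono) (auto simp: algebra_simps)
    then show ?thesis
      by (simp add: poly_pderiv_cgegenbauer_of_real pderiv_gegenbauer[OF l(1)] norm_mult)
  qed
  ultimately have "cmod (poly (pderiv ?P) (of_real x)) / (2 * pi) * cmod G
      \<le> 2 * \<bar>l\<bar> * gcoeff (2 * l + 2) n / (2 * pi) * (?M / (\<kappa> * \<delta>) * (pi * ?s))"
    by (intro mult_mono divide_right_mono)
      (use l gcoeff_pos[of "2 * l + 2" n] in \<open>auto intro: order_trans[OF norm_ge_zero]\<close>)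
  also have "\<dots> = ?rhs"
    using \<rho> \<kappa>(1) by (simp add: \<delta>_def field_simps)
  finally show "cmod (deriv (\<lambda>z. u z - poly p z) (of_real x)) \<le> ?rhs"
    unfolding deriv_eq by (simp add: norm_mult norm_divide)
qed

lemma Lambda_bound_eq:
  assumes "\<rho> > 1"
  shows "Lambda_bound c M \<rho> l =
    2 * c * Gamma (l + 1) * M * sqrt (\<rho>\<^sup>2 + 1 / \<rho>\<^sup>2) / (Gamma (2 * l + 2) * (\<rho> - 1)\<^sup>2 * ellipse_modulus \<rho> l)"
proof -
  have "\<rho> powi 2 = \<rho>\<^sup>2" "\<rho> powi (-2) = 1 / \<rho>\<^sup>2"
    by (simp_all add: power_int_def inverse_eq_divide power_one_over)
  then show ?thesis
    by (simp add: Lambda_bound_def ellipse_modulus_def powr_minus field_simps)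
qed

theorem theorem4p2:
  fixes l \<rho> :: real
  assumes "l > -1/2" and "l \<noteq> 0" and "\<rho> > 1"
  shows "\<exists>c :: nat \<Rightarrow> real. (\<forall>n. c n > 0) \<and> c \<longlonglongrightarrow> 1 \<and>
    (\<forall>n\<ge>1. \<forall>(u :: complex \<Rightarrow> complex) (p :: complex poly).
       u analytic_on (bernstein_ellipse \<rho> \<union> inside (bernstein_ellipse \<rho>)) \<longrightarrow>
       is_gauss_interpolant l n u p \<longrightarrow>
       Max ((\<lambda>x. cmod (deriv (\<lambda>z. u z - poly p z) (complex_of_real x)))
              ` gegenbauer_gauss_points l n)
       \<le> Lambda_bound (c n) (ellipse_max \<rho> u) \<rho> l * (real n powr (l + 2) / \<rho> ^ n))"
proof -
  note l = assms(1,2) and \<rho> = assms(3)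
  define m where "m = ellipse_modulus \<rho> l"
  have "m > 0" unfolding m_def by (rule ellipse_modulus_pos[OF \<rho>])
  have Gpos: "Gamma (2 * l + 2) > 0" "Gamma (l + 1) > 0"
    using l by (auto intro: Gamma_real_pos)
  have gpos: "gcoeff (2 * l + 2) n > 0" for n
    using l by (intro gcoeff_pos) auto
  obtain \<epsilon> where \<epsilon>: "\<epsilon> \<longlonglongrightarrow> 0" "\<And>n z. z \<in> bernstein_ellipse \<rho> \<Longrightarrow>
      \<bar>gcoeff l n\<bar> * \<rho> ^ n * (m - \<epsilon> n) \<le> cmod (poly (cgegenbauer l n) z)"
    unfolding m_def by (rule cgegenbauer_ellipse_lower_bound[OF l \<rho>]) blast
  have "\<exists>\<kappa>. \<forall>n. \<kappa> n > 0 \<and> (\<forall>z \<in> bernstein_ellipse \<rho>. \<kappa> n \<le> cmod (poly (cgegenbauer l (Suc n)) z))"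
    by (rule choice) (metis cgegenbauer_ellipse_bounded_below[OF l \<rho>])
  then obtain \<kappa>0 where \<kappa>0: "\<And>n. \<kappa>0 n > 0"
    "\<And>n z. z \<in> bernstein_ellipse \<rho> \<Longrightarrow> \<kappa>0 n \<le> cmod (poly (cgegenbauer l (Suc n)) z)"
    by blast
  define \<kappa>1 where "\<kappa>1 n = \<bar>gcoeff l (Suc n)\<bar> * \<rho> ^ Suc n * (m - \<epsilon> (Suc n))" for n
  \<comment> \<open>The asymptotic bound is taken wherever it is positive, which holds for all large
    \<open>n\<close>; elsewhere the compactness bound keeps \<open>c n\<close> finite and
    positive.\<close>
  define \<kappa> where "\<kappa> n = (if \<kappa>1 n > 0 then \<kappa>1 n else \<kappa>0 n)" for n
  have \<kappa>: "\<kappa> n > 0" "z \<in> bernstein_ellipse \<rho> \<Longrightarrow> \<kappa> n \<le> cmod (poly (cgegenbauer l (Suc n)) z)" for n z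
    using \<kappa>0 \<epsilon>(2)[of z "Suc n"] by (auto simp: \<kappa>_def \<kappa>1_def)
  \<comment> \<open>Solved from the requirement that the bound of
    \<open>gauss_interpolation_derivative_bound\<close> equal the claimed one. At
    \<open>n = 0\<close> the factor \<open>real n powr (l + 2)\<close> is 0 and the quotient would
    not be positive.\<close>
  define c where "c n = (if n = 0 then 1 else \<bar>l\<bar> * gcoeff (2 * l + 2) n * \<rho> ^ Suc n * m * Gamma (2 * l + 2) /
      (\<kappa> n * Gamma (l + 1) * real n powr (l + 2)))" for n
  have "c n > 0" for n
    unfolding c_def using l \<rho> Gpos gpos[of n] \<open>m > 0\<close> \<kappa>(1)[of n] by auto
  moreover have "c \<longlonglongrightarrow> 1"
  proof -
    \<comment> \<open>Once \<open>m - \<epsilon> (Suc n)\<close> is positive,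
      \<open>\<kappa>\<close> is the asymptotic bound, the powers of \<open>\<rho>\<close> in
      \<open>c n\<close> cancel, and the Gamma quotient times
      \<open>m / (m - \<epsilon> (Suc n))\<close> remains.\<close>
    have lim: "(\<lambda>n. m - \<epsilon> (Suc n)) \<longlonglongrightarrow> m"
      using tendsto_diff[OF tendsto_const[of m] LIMSEQ_Suc[OF \<epsilon>(1)]] by simp
    have "(\<lambda>n. \<bar>l\<bar> * gcoeff (2 * l + 2) n * Gamma (2 * l + 2) /
      (\<bar>gcoeff l (Suc n)\<bar> * Gamma (l + 1) * real n powr (l + 2)) * (m / (m - \<epsilon> (Suc n)))) \<longlonglongrightarrow> 1 * (m / m)"
      using \<open>m > 0\<close> by (intro tendsto_mult gcoeff_Gamma_ratio_tendsto[OF l] tendsto_divide tendsto_const lim) auto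
    then have "(\<lambda>n. \<bar>l\<bar> * gcoeff (2 * l + 2) n * Gamma (2 * l + 2) /
      (\<bar>gcoeff l (Suc n)\<bar> * Gamma (l + 1) * real n powr (l + 2)) * (m / (m - \<epsilon> (Suc n)))) \<longlonglongrightarrow> 1"
      using \<open>m > 0\<close> by simp
    moreover have "\<forall>\<^sub>F n in sequentially. \<bar>l\<bar> * gcoeff (2 * l + 2) n * Gamma (2 * l + 2) /
      (\<bar>gcoeff l (Suc n)\<bar> * Gamma (l + 1) * real n powr (l + 2)) * (m / (m - \<epsilon> (Suc n))) = c n"
      using order_tendstoD(1)[OF lim \<open>m > 0\<close>] eventually_gt_at_top[of 0]
    proof eventually_elim
      case (elim n)
      have "\<kappa> n = \<bar>gcoeff l (Suc n)\<bar> * \<rho> ^ Suc n * (m - \<epsilon> (Suc n))"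
        using elim gcoeff_nz[OF l, of "Suc n"] \<rho> by (simp add: \<kappa>_def \<kappa>1_def)
      then show ?case using elim \<rho> by (simp add: c_def mult_ac)
    qed
    ultimately show ?thesis by (rule Lim_transform_eventually)
  qed
  moreover have "Max ((\<lambda>x. cmod (deriv (\<lambda>z. u z - poly p z) (complex_of_real x))) ` gegenbauer_gauss_points l n)
       \<le> Lambda_bound (c n) (ellipse_max \<rho> u) \<rho> l * (real n powr (l + 2) / \<rho> ^ n)"
    if "n \<ge> 1" and u: "u analytic_on (bernstein_ellipse \<rho> \<union> inside (bernstein_ellipse \<rho>))"
      and p: "is_gauss_interpolant l n u p" for n u p
  proof -
    \<comment> \<open>\<open>Max\<close> is bounded through its elements, which takes a finite
      nonempty set of nodes.\<close>
    have "gegenbauer_gauss_points l n \<noteq> {}"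
      using card_gauss_points(1)[OF l, of n] by auto
    moreover have "2 * \<bar>l\<bar> * gcoeff (2 * l + 2) n * ellipse_max \<rho> u * sqrt (\<rho>\<^sup>2 + 1 / \<rho>\<^sup>2) * \<rho> / ((\<rho> - 1)\<^sup>2 * \<kappa> n)
       = Lambda_bound (c n) (ellipse_max \<rho> u) \<rho> l * (real n powr (l + 2) / \<rho> ^ n)"
      using \<open>n \<ge> 1\<close> \<rho> Gpos \<open>m > 0\<close> \<kappa>(1)[of n]
      by (simp add: Lambda_bound_eq[OF \<rho>] c_def mult_ac flip: m_def)
    ultimately show ?thesis
      using gauss_interpolation_derivative_bound[OF l \<rho> \<kappa> u p] card_gauss_points(2)[OF l]
      by simp
  qed
  ultimately show ?thesis by blast
qed

end
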